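(* Let $f\in\mathscr{F}$ be a meromorphic function $f:\mathbb{C}^n\to\mathbb{C}^k$ such that there is a single pole at $0$ of order at most $1$, with residue matrix $\eta$ and Jacobian matrix $\mathscr{D}$. Then the variance of $f$ over the Unit Lens $\mathscr{L}=\{(D^n_\lambda,\mathscr{E}^n_\lambda,\mu^n_\lambda)\}_{\lambda\downarrow0}$ using the exterior probability $\mu^n_\lambda$ is given by $$V_\lambda(f)=\langle f,f\rangle-\|E(f)\|^2=\frac{\mathrm{Tr}(\eta^*\eta)}{\lambda^2}+\lambda^2\,\mathrm{Tr}(\mathscr{D}^*\mathscr{D}).$$
   Context: Exterior probability. For $\lambda>0$ and an interval $I\subset[-\pi,\pi]$, put $\Gamma_\lambda(I)=\{w\in\mathbb{C}: |w|\le\lambda,\ \arg(w)\in I\}$ and $\gamma_\lambda(I)=\{w\in\mathbb{C}: |w|=\lambda,\ \arg(w)\in I\}$ (traversed counterclockwise). Let $\mathscr{E}_\lambda$ be the $\sigma$-algebra on $\{|w|\le\lambda\}$ generated by all $\Gamma_\lambda(I)$, and $\mu_\lambda$ the measure on $\mathscr{E}_\lambda$ extending $\mu_\lambda(\Gamma_\lambda(I))=\frac{1}{2\pi i}\int_{\gamma_\lambda(I)}\frac{dw}{w}$. $(\mathscr{E}^n_\lambda,\mu^n_\lambda)$ is the $n$-fold product on the closed poly-disc $D^n_\lambda=D_\lambda=\{w\in\mathbb{C}^n:|w_\alpha|\le\lambda\ \forall\alpha\}$; $\mu^n_\lambda$ is the exterior probability, and the family indexed by $\lambda$ is the Unit Lens.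 Contour integral convention. $\oint_{D_\lambda}F$ denotes the iterated contour integral of $F(w)\,dw_1\cdots dw_n$ over $\{|w_1|=\lambda\}\times\cdots\times\{|w_n|=\lambda\}$. Functions. $\mathscr{F}$ is the vector space of all meromorphic functions $f:\mathbb{C}^n\to\mathbb{C}^k$ which have a potential pole of order at most $1$ at $0$ and are $\mu^n_\lambda$-measurable over $D^n_\lambda$. Expectation and inner product are $$E(f)=\int_{D_\lambda}f\,d\mu^n_\lambda=\frac{1}{(2\pi i)^n}\oint_{D_\lambda}\frac{f(w)}{\prod_\alpha w_\alpha},\qquad \langle f,g\rangle=\int_{D_\lambda}f^*g\,d\mu^n_\lambda=\frac{1}{(2\pi i)^n}\oint_{D_\lambda}\frac{f(w)^*g(w)}{\prod_\alpha w_\alpha},$$ where $^*$ is conjugate transpose. Decomposition. $f=f_0+f_P+f_A$, where the core is $f_0^\alpha=\frac{1}{(2\pi i)^n}\oint_{D_\lambda}\frac{f^\alpha(w)}{\prod_{\mu}w_\mu}$; the principal component is $f_P^\alpha=\sum_{\beta=1}^n\frac{\eta^\alpha_\beta}{w_\beta}$ with residue matrix $\eta^\alpha_\beta=\frac{1}{(2\pi i)^n}\oint_{D_\lambda}\frac{f^\alpha(w)}{\prod_{\mu\ne\beta}w_\mu}$; and the analytic component $f_A=f-f_0-f_P$ is given within a radius of convergence $R$ (i.e. for $|w_\beta|<R$ for all $\beta$) by $f_A^\alpha=\sum_\beta\mathscr{D}^{\alpha\beta}w_\beta+P^\alpha(w)$ with $P^\alpha$ a power series of lowest degree at least $2$ and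 $\mathscr{D}^{\alpha\beta}=\partial f_A^\alpha/\partial w_\beta|_{w=0}$ the Jacobian matrix.
   Formalization: The printed equality fails for f(w)=w² (variance λ⁴, right side 0); what is proved is the equality with the extra term ⟨P,P⟩ for every λ<R, P being the part of f_A of degree at least 2, and hence the printed formula up to O(λ⁴) as λ↓0. *)

theory Defs
  imports "HOL-Complex_Analysis.Complex_Analysis" "HOL-Library.Landau_Symbols"
begin

unbundle no fps_syntax

section \<open>Exterior probability\<close>

definition sector :: "real \<Rightarrow> real set \<Rightarrow> complex set" where
  "sector r I = {w. cmod w \<le> r \<and> Arg w \<in> I}"

definition sector_arc :: "real \<Rightarrow> real set \<Rightarrow> real \<Rightarrow> complex" where
  "sector_arc r I = part_circlepath 0 r (Inf I) (Sup I)"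

text \<open>The empty interval only contributes the empty sector; it is left out because \<open>Inf {}\<close> and
  \<open>Sup {}\<close> carry no information on \<open>real\<close>.\<close>

definition arg_intervals :: "real set set" where
  "arg_intervals = {I. is_interval I \<and> I \<noteq> {} \<and> I \<subseteq> {-pi..pi}}"

definition ext_prob :: "real \<Rightarrow> complex measure" where
  "ext_prob r = extend_measure (cball 0 r) arg_intervals (sector r)
     (\<lambda>I. ennreal (Re (1 / (2 * complex_of_real pi * \<i>) * contour_integral (sector_arc r I) (\<lambda>w. 1 / w))))"

definition ext_prob_n :: "real \<Rightarrow> (complex ^ 'n) measure" where
  "ext_prob_n r = embed_measure (\<Pi>\<^sub>M \<alpha>\<in>(UNIV :: 'n set). ext_prob r) vec_lambda"

text \<open>A set of the \<open>\<sigma>\<close>-algebra of \<open>ext_prob_n r\<close> is a union of radial segments, and it is measured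
  through the arcs it cuts out of the torus \<open>|w\<^sub>\<alpha>| = r\<close>. Accordingly, measurability and integration
  of a function on the polydisc refer to its values on the torus, transported along the radii. (Read
  pointwise inside the polydisc, measurability would leave only functions that are constant along
  radii, and the integral would not be the contour integral.) Lemma \<open>integral_ext_prob_n\<close> below
  shows that the resulting integral is \<open>1 / (2\<pi>\<i>)\<^sup>n\<close> times the iterated contour integral
  of \<open>f(w) / \<Prod>w\<^sub>\<alpha>\<close>.\<close>

definition to_torus :: "real \<Rightarrow> complex ^ 'n \<Rightarrow> complex ^ 'n" where
  "to_torus r w = (\<chi> \<alpha>. rcis r (Arg (w $ \<alpha>)))"

definition lens_measurable :: "real \<Rightarrow> (complex ^ 'n \<Rightarrow> complex ^ 'k) \<Rightarrow> bool" where
  "lens_measurable r f \<longleftrightarrow> (\<lambda>w. f (to_torus r w)) \<in> borel_measurable (ext_prob_n r)"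

definition lens_integral ::
    "real \<Rightarrow> (complex ^ 'n \<Rightarrow> 'b) \<Rightarrow> 'b :: {banach, second_countable_topology}" where
  "lens_integral r f = (\<integral>w. f (to_torus r w) \<partial>ext_prob_n r)"

definition lens_inner ::
    "real \<Rightarrow> (complex ^ 'n \<Rightarrow> complex ^ 'k) \<Rightarrow> (complex ^ 'n \<Rightarrow> complex ^ 'k) \<Rightarrow> complex" where
  "lens_inner r f g = lens_integral r (\<lambda>w. \<Sum>\<alpha>\<in>UNIV. cnj (f w $ \<alpha>) * g w $ \<alpha>)"

definition lens_variance :: "real \<Rightarrow> (complex ^ 'n \<Rightarrow> complex ^ 'k) \<Rightarrow> complex" where
  "lens_variance r f = lens_inner r f f - complex_of_real ((norm (lens_integral r f))\<^sup>2)"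


section \<open>Iterated contour integrals\<close>

primrec iterated_contour ::
    "real \<Rightarrow> 'n list \<Rightarrow> (complex ^ 'n \<Rightarrow> complex) \<Rightarrow> complex ^ 'n \<Rightarrow> complex" where
  "iterated_contour r [] F w = F w"
| "iterated_contour r (\<alpha> # \<alpha>s) F w =
     contour_integral (circlepath 0 r)
       (\<lambda>z. iterated_contour r \<alpha>s F (\<chi> \<beta>. if \<beta> = \<alpha> then z else w $ \<beta>))"

text \<open>All coordinates are integrated out, so the initial point \<open>0\<close> is irrelevant.\<close>

definition torus_contour ::
    "real \<Rightarrow> (complex ^ ('n :: {finite, linorder}) \<Rightarrow> complex) \<Rightarrow> complex" where
  "torus_contour r F = iterated_contour r (sorted_list_of_set UNIV) F 0"


section \<open>The integral is the contour integral\<close>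

text \<open>The measure required in \<open>ext_prob\<close> exists and is unique: it is the law of \<open>rcis r t\<close> for \<open>t\<close>
  uniformly distributed on \<open>{-pi<..pi}\<close>.\<close>

lemma Arg_measurable: "Arg \<in> borel_measurable borel"
proof (rule measurable_piecewise_restrict[where C = "{\<real>\<^sub>\<le>\<^sub>0 - {0}, {0}, - \<real>\<^sub>\<le>\<^sub>0}"])
  fix X :: "complex set" assume X: "X \<in> {\<real>\<^sub>\<le>\<^sub>0 - {0}, {0}, - \<real>\<^sub>\<le>\<^sub>0}"
  have cl: "closed (\<real>\<^sub>\<le>\<^sub>0 :: complex set)" by simp
  then have "(\<real>\<^sub>\<le>\<^sub>0 :: complex set) \<in> sets borel" by (rule borel_closed)
  then show "X \<inter> space borel \<in> sets borel" using X by auto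
  have "continuous_on X Arg"
    using X
  proof (elim insertE emptyE)
    assume "X = \<real>\<^sub>\<le>\<^sub>0 - {0}"
    moreover have "Arg z = pi" if "z \<in> \<real>\<^sub>\<le>\<^sub>0 - {0}" for z
      using that by (auto simp: complex_nonpos_Reals_iff Arg_eq_pi complex_eq_iff)
    ultimately show ?thesis by (metis continuous_on_cong continuous_on_const)
  qed (auto intro: continuous_on_Arg)
  then show "Arg \<in> borel_measurable (restrict_space borel X)"
    by (rule borel_measurable_continuous_on_restrict)
qed auto

lemma contour_integral_sector_arc:
  assumes "r > 0" "a \<le> b"
  shows "contour_integral (part_circlepath 0 r a b) (\<lambda>w. 1 / w) = \<i> * of_real (b - a)"
proof (cases "a = b")
  case True
  then have "part_circlepath 0 r a b = linepath (rcis r a) (rcis r a)"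
    by (auto simp: part_circlepath_def linepath_def rcis_def cis_conv_exp algebra_simps)
  then show ?thesis using True by simp
next
  case False
  with assms have "a < b" by simp
  have "contour_integral (part_circlepath 0 r a b) (\<lambda>w. 1 / w) = integral {a..b} (\<lambda>t. \<i>)"
    unfolding contour_integral_part_circlepath_eq[OF \<open>a < b\<close>]
    using assms by (intro integral_cong) (auto simp: field_simps)
  then show ?thesis using assms by (simp add: algebra_simps scaleR_conv_of_real)
qed

lemma arg_intervals_cases:
  assumes "I \<in> arg_intervals"
  obtains a b where "a \<le> b" "-pi \<le> a" "b \<le> pi" "Inf I = a" "Sup I = b" "{a<..<b} \<subseteq> I" "I \<subseteq> {a..b}"
proof -
  have I: "is_interval I" "I \<noteq> {}" "I \<subseteq> {-pi..pi}" using assms by (auto simp: arg_intervals_def)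
  have bdd: "bdd_above I" "bdd_below I" using I(3)
    by (meson bdd_above_Icc bdd_above_mono, meson bdd_below_Icc bdd_below_mono)
  show ?thesis
  proof (rule that[OF _ _ _ refl refl])
    show "Inf I \<le> Sup I" using I bdd by (simp add: cInf_le_cSup)
    show "-pi \<le> Inf I" using I by (intro cInf_greatest) auto
    show "Sup I \<le> pi" using I by (intro cSup_least) auto
    show "I \<subseteq> {Inf I..Sup I}" using bdd by (auto intro: cInf_lower cSup_upper)
    show "{Inf I<..<Sup I} \<subseteq> I"
    proof
      fix x assume "x \<in> {Inf I<..<Sup I}"
      then obtain y z where "y \<in> I" "y < x" "z \<in> I" "x < z"
        using I bdd by (auto simp: cInf_less_iff less_cSup_iff)
      then show "x \<in> I" using I(1) unfolding is_interval_1 by (meson less_imp_le)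
    qed
  qed
qed

definition ang_meas :: "real measure" where
  "ang_meas = density lborel (\<lambda>t. ennreal (indicator {-pi<..pi} t / (2 * pi)))"

lemma sets_ang: "sets ang_meas = sets borel" "space ang_meas = UNIV"
  by (simp_all add: ang_meas_def)

lemma emeasure_ang:
  assumes "A \<in> sets borel"
  shows "emeasure ang_meas A = emeasure lborel (A \<inter> {-pi<..pi}) / ennreal (2 * pi)"
proof -
  have "emeasure ang_meas A = (\<integral>\<^sup>+t. indicator (A \<inter> {-pi<..pi}) t / ennreal (2 * pi) \<partial>lborel)"
    unfolding ang_meas_def using assms
    by (subst emeasure_density) (auto intro!: nn_integral_cong simp: indicator_def divide_ennreal[symmetric])
  also have "\<dots> = emeasure lborel (A \<inter> {-pi<..pi}) / ennreal (2 * pi)"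
    using assms by (simp add: nn_integral_divide)
  finally show ?thesis .
qed

lemma prob_space_ang: "emeasure ang_meas UNIV = 1"
  by (subst emeasure_ang) (auto simp: divide_ennreal)

lemma Arg_rcis_mem:
  assumes "r > 0" "t \<in> {-pi<..pi}" shows "Arg (rcis r t) = t"
  using assms by (simp add: Arg_rcis)

lemma emeasure_lborel_between:
  assumes "a \<le> b" "{a<..<b} \<subseteq> X" "X \<subseteq> {a..b}" "X \<in> sets borel"
  shows "emeasure lborel X = ennreal (b - a)"
proof (rule antisym)
  show "emeasure lborel X \<le> ennreal (b - a)"
    using emeasure_mono[of X "{a..b}" lborel] assms by simp
  show "ennreal (b - a) \<le> emeasure lborel X"
    using emeasure_mono[of "{a<..<b}" X lborel] assms by simp
qed

definition sector_alg :: "real \<Rightarrow> complex measure" where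
  "sector_alg r = sigma (cball 0 r) (sector r ` arg_intervals)"

lemma sector_sub: "sector r ` arg_intervals \<subseteq> Pow (cball 0 r)"
  by (auto simp: sector_def)

lemma sets_sector_alg: "sets (sector_alg r) = sigma_sets (cball 0 r) (sector r ` arg_intervals)"
  "space (sector_alg r) = cball 0 r"
  using sector_sub[of r] by (simp_all add: sector_alg_def)

lemma sets_ext_prob: "sets (ext_prob r) = sets (sector_alg r)" "space (ext_prob r) = cball 0 r"
  using sector_sub[of r] unfolding ext_prob_def
  by (simp_all add: sets_extend_measure space_extend_measure sets_sector_alg)

lemma rcis_measurable:
  assumes "r > 0" shows "rcis r \<in> measurable ang_meas (sector_alg r)"
  unfolding sector_alg_def
proof (rule measurable_measure_of[OF sector_sub])
  show "rcis r \<in> space ang_meas \<rightarrow> cball 0 r" using assms by auto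
  fix y assume "y \<in> sector r ` arg_intervals"
  then obtain I where I: "I \<in> arg_intervals" "y = sector r I" by auto
  have [measurable]: "I \<in> sets borel" using I real_interval_borel_measurable by (auto simp: arg_intervals_def)
  have rm: "rcis r \<in> borel_measurable borel"
    unfolding rcis_def[abs_def] by (intro borel_measurable_continuous_onI continuous_intros)
  have "rcis r -` y \<inter> space ang_meas = (\<lambda>t. Arg (rcis r t)) -` I \<inter> space borel"
    using assms by (auto simp: I sector_def sets_ang)
  also have "\<dots> \<in> sets borel"
    using measurable_compose[OF rm Arg_measurable] by (rule measurable_sets) simp
  finally show "rcis r -` y \<inter> space ang_meas \<in> sets ang_meas" by (simp add: sets_ang)
qed

lemma emeasure_distr_ang:
  assumes "r > 0" "I \<in> arg_intervals"
  shows "emeasure (distr ang_meas (sector_alg r) (rcis r)) (sector r I) =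
    ennreal (Re (1 / (2 * complex_of_real pi * \<i>) * contour_integral (sector_arc r I) (\<lambda>w. 1 / w)))"
proof -
  obtain a b where ab: "a \<le> b" "-pi \<le> a" "b \<le> pi" "Inf I = a" "Sup I = b" "{a<..<b} \<subseteq> I" "I \<subseteq> {a..b}"
    using arg_intervals_cases[OF assms(2)] by metis
  have [measurable]: "I \<in> sets borel"
    using assms real_interval_borel_measurable by (auto simp: arg_intervals_def)
  have inS: "sector r I \<in> sets (sector_alg r)"
    unfolding sets_sector_alg using assms by auto
  have pre: "rcis r -` sector r I \<in> sets borel"
    using measurable_sets[OF rcis_measurable[OF assms(1)] inS] by (simp add: sets_ang)
  have "emeasure (distr ang_meas (sector_alg r) (rcis r)) (sector r I) =
      emeasure lborel (rcis r -` sector r I \<inter> {-pi<..pi}) / ennreal (2 * pi)"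
    using pre by (simp add: emeasure_distr[OF rcis_measurable[OF assms(1)] inS] sets_ang emeasure_ang)
  also have "rcis r -` sector r I \<inter> {-pi<..pi} = I \<inter> {-pi<..pi}"
    using assms(1) by (auto simp: sector_def Arg_rcis)
  also have "emeasure lborel (I \<inter> {-pi<..pi}) = ennreal (b - a)"
    using ab by (intro emeasure_lborel_between) auto
  also have "ennreal (b - a) / ennreal (2 * pi) = ennreal ((b - a) / (2 * pi))"
    using ab by (simp add: divide_ennreal)
  also have "(b - a) / (2 * pi) =
      Re (1 / (2 * complex_of_real pi * \<i>) * contour_integral (sector_arc r I) (\<lambda>w. 1 / w))"
  proof -
    have "1 / (2 * complex_of_real pi * \<i>) * contour_integral (sector_arc r I) (\<lambda>w. 1 / w)
       = of_real ((b - a) / (2 * pi))"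
      unfolding sector_arc_def ab(4,5) contour_integral_sector_arc[OF assms(1) ab(1)]
      by (simp add: field_simps)
    then show ?thesis by simp
  qed
  finally show ?thesis .
qed

lemma emeasure_ext_prob:
  assumes "r > 0" "I \<in> arg_intervals"
  shows "emeasure (ext_prob r) (sector r I) =
    ennreal (Re (1 / (2 * complex_of_real pi * \<i>) * contour_integral (sector_arc r I) (\<lambda>w. 1 / w)))"
proof (rule emeasure_extend_measure[OF ext_prob_def _ sector_sub _ _ assms(2),
      where \<mu>' = "emeasure (distr ang_meas (sector_alg r) (rcis r))"])
  have s: "sets (ext_prob r) = sets (distr ang_meas (sector_alg r) (rcis r))"
    by (simp add: sets_ext_prob)
  show "positive (sets (ext_prob r)) (emeasure (distr ang_meas (sector_alg r) (rcis r)))"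
    unfolding s by (rule emeasure_positive)
  show "countably_additive (sets (ext_prob r)) (emeasure (distr ang_meas (sector_alg r) (rcis r)))"
    unfolding s by (rule emeasure_countably_additive)
qed (use emeasure_distr_ang[OF assms(1)] in auto)

lemma ext_prob_eq_distr:
  assumes "r > 0"
  shows "ext_prob r = distr ang_meas (sector_alg r) (rcis r)"
proof (rule measure_eqI_generator_eq[where E = "insert {} (sector r ` arg_intervals)" and \<Omega> = "cball 0 r"
      and A = "\<lambda>_. cball 0 r"])
  have full: "cball 0 r = sector r {-pi..pi}"
    using Arg_bounded by (auto simp: sector_def less_imp_le)
  have fi: "{-pi..pi} \<in> arg_intervals" by (auto simp: arg_intervals_def is_interval_cc)
  show "Int_stable (insert {} (sector r ` arg_intervals))"
  proof (rule Int_stableI)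
    fix X Y assume XY: "X \<in> insert {} (sector r ` arg_intervals)" "Y \<in> insert {} (sector r ` arg_intervals)"
    show "X \<inter> Y \<in> insert {} (sector r ` arg_intervals)"
    proof (cases "X \<inter> Y = {}")
      case False
      then obtain I J where IJ: "I \<in> arg_intervals" "J \<in> arg_intervals" "X = sector r I" "Y = sector r J"
        using XY by auto
      have "X \<inter> Y = sector r (I \<inter> J)" using IJ by (auto simp: sector_def)
      moreover have "I \<inter> J \<in> arg_intervals"
        using IJ False by (auto simp: arg_intervals_def is_interval_Int sector_def)
      ultimately show ?thesis by auto
    qed simp
  qed
  show "insert {} (sector r ` arg_intervals) \<subseteq> Pow (cball 0 r)" using sector_sub by auto
  have ss: "sigma_sets (cball 0 r) (insert {} (sector r ` arg_intervals)) =
      sigma_sets (cball 0 r) (sector r ` arg_intervals)"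
    by (intro sigma_sets_eqI) (auto intro: sigma_sets.intros)
  show "sets (ext_prob r) = sigma_sets (cball 0 r) (insert {} (sector r ` arg_intervals))"
    "sets (distr ang_meas (sector_alg r) (rcis r)) = sigma_sets (cball 0 r) (insert {} (sector r ` arg_intervals))"
    unfolding ss by (simp_all add: sets_ext_prob sets_sector_alg)
  show "emeasure (ext_prob r) X = emeasure (distr ang_meas (sector_alg r) (rcis r)) X"
    if "X \<in> insert {} (sector r ` arg_intervals)" for X
    using that emeasure_ext_prob[OF assms] emeasure_distr_ang[OF assms] by auto
  show "range (\<lambda>_. cball 0 r) \<subseteq> insert {} (sector r ` arg_intervals)"
    using full fi by auto
  show "emeasure (ext_prob r) (cball 0 r) \<noteq> \<infinity>"
    unfolding full emeasure_ext_prob[OF assms fi] by simp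
qed auto

lemma emeasure_ext_prob_space:
  assumes "r > 0" shows "emeasure (ext_prob r) (space (ext_prob r)) = 1"
proof -
  have "rcis r -` cball 0 r = UNIV" using assms by auto
  then show ?thesis
    using rcis_measurable[OF assms] sets.top[of "sector_alg r"]
    by (simp add: ext_prob_eq_distr[OF assms] emeasure_distr sets_sector_alg sets_ang prob_space_ang)
qed

lemma integral_periodic_shift:
  fixes \<phi> :: "real \<Rightarrow> complex"
  assumes m: "\<phi> \<in> borel_measurable borel" and B: "\<And>t. norm (\<phi> t) \<le> B"
    and per: "\<And>t. \<phi> (t + 2 * pi) = \<phi> t"
  shows "integral {0..2*pi} \<phi> = integral {-pi..pi} \<phi>"
    and "\<And>a b. set_integrable lborel {a..b} \<phi>"
proof -
  show si: "set_integrable lborel {a..b} \<phi>" for a b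
    unfolding set_integrable_def
  proof (rule Bochner_Integration.integrable_bound)
    show "integrable lborel (\<lambda>t. indicat_real {a..b} t *\<^sub>R B)"
      by (intro integrable_scaleR_left integrable_real_indicator) (auto simp: emeasure_lborel_Icc_eq)
    show "AE x in lborel. norm (indicat_real {a..b} x *\<^sub>R \<phi> x) \<le> norm (indicat_real {a..b} x *\<^sub>R B)"
      using order_trans[OF B abs_ge_self] by (auto simp: indicator_def)
  qed (use m in measurable)
  have io: "\<phi> integrable_on {a..b}" for a b
    using set_borel_integral_eq_integral(1)[OF si] .
  have "integral {0..2*pi} \<phi> = integral {0..pi} \<phi> + integral {pi..2*pi} \<phi>"
    by (rule Henstock_Kurzweil_Integration.integral_combine[symmetric]) (auto intro: io)
  also have "integral {pi..2*pi} \<phi> = integral {-pi..0} \<phi>"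
    using integral_shift_real_ivl[of pi "2*pi" "2*pi" \<phi>] per by simp
  also have "integral {0..pi} \<phi> + integral {-pi..0} \<phi> = integral {-pi..pi} \<phi>"
    using Henstock_Kurzweil_Integration.integral_combine[of "-pi" 0 pi \<phi>] io by (simp add: add.commute)
  finally show "integral {0..2*pi} \<phi> = integral {-pi..pi} \<phi>" .
qed

lemma Arg_ext_prob [measurable]: "Arg \<in> borel_measurable (ext_prob r)"
proof (rule borel_measurableI_le)
  fix y :: real
  show "{x \<in> space (ext_prob r). Arg x \<le> y} \<in> sets (ext_prob r)"
  proof (cases "-pi \<le> y")
    case False
    then have "{x \<in> space (ext_prob r). Arg x \<le> y} = {}"
      by (auto simp: not_le intro: less_trans[OF _ conjunct1[OF Arg_bounded]])
    then show ?thesis by (metis sets.empty_sets)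
  next
    case True
    have "{x \<in> space (ext_prob r). Arg x \<le> y} = sector r {-pi..min y pi}"
      using Arg_bounded by (auto simp: sets_ext_prob sector_def less_imp_le)
    moreover have "{-pi..min y pi} \<in> arg_intervals" using True
      by (auto simp: arg_intervals_def is_interval_cc)
    ultimately show ?thesis by (auto simp: sets_ext_prob(1) sets_sector_alg)
  qed
qed

lemma ext_prob_integral:
  fixes g :: "complex \<Rightarrow> complex"
  assumes r: "r > 0" and m: "(\<lambda>t. g (rcis r t)) \<in> borel_measurable borel"
    and B: "\<And>t. norm (g (rcis r t)) \<le> B"
  shows "contour_integral (circlepath 0 r) g =
    2 * of_real pi * \<i> * (\<integral>w. g (rcis r (Arg w)) * rcis r (Arg w) \<partial>ext_prob r)"
proof -
  define \<phi> where "\<phi> t = g (rcis r t) * rcis r t" for t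
  have rc: "rcis r \<in> borel_measurable borel"
    unfolding rcis_def[abs_def] by (intro borel_measurable_continuous_onI continuous_intros)
  have m\<phi>[measurable]: "\<phi> \<in> borel_measurable borel"
    unfolding \<phi>_def using m rc by measurable
  have b\<phi>: "norm (\<phi> t) \<le> B * r" for t
    unfolding \<phi>_def norm_mult using B[of t] r by (auto intro: mult_right_mono)
  have per: "\<phi> (t + 2 * pi) = \<phi> t" for t
  proof -
    have "rcis r (t + 2 * pi) = rcis r t" by (simp add: complex_eq_iff)
    then show ?thesis unfolding \<phi>_def by simp
  qed
  note P = integral_periodic_shift[OF m\<phi> b\<phi> per]
  have "contour_integral (circlepath 0 r) g = integral {0..2*pi} (\<lambda>t. \<i> * \<phi> t)"
    unfolding circlepath_def contour_integral_part_circlepath_eq[OF pi_gt_zero[THEN mult_pos_pos[of 2, OF zero_less_numeral]]]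
    by (intro integral_cong) (simp add: \<phi>_def rcis_def algebra_simps)
  also have "\<dots> = \<i> * integral {-pi..pi} \<phi>"
    using P(1) by simp
  also have "integral {-pi..pi} \<phi> = (LBINT t:{-pi..pi}. \<phi> t)"
    using set_borel_integral_eq_integral(2)[OF P(2)] by simp
  also have "\<dots> = (\<integral>t. (indicator {-pi<..pi} t) *\<^sub>R \<phi> t \<partial>lborel)"
    unfolding set_lebesgue_integral_def
    by (rule integral_cong_AE) (use AE_lborel_singleton[of "-pi"] in \<open>auto elim!: eventually_mono simp: indicator_def\<close>)
  also have "\<dots> = 2 * of_real pi * (\<integral>t. (indicator {-pi<..pi} t / (2 * pi)) *\<^sub>R \<phi> t \<partial>lborel)"
  proof -
    have "(\<integral>t. (indicator {-pi<..pi} t / (2 * pi)) *\<^sub>R \<phi> t \<partial>lborel) =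
          (\<integral>t. (1 / (2 * pi)) *\<^sub>R ((indicator {-pi<..pi} t) *\<^sub>R \<phi> t) \<partial>lborel)"
      by (intro Bochner_Integration.integral_cong) auto
    also have "\<dots> = (1 / (2 * pi)) *\<^sub>R (\<integral>t. (indicator {-pi<..pi} t) *\<^sub>R \<phi> t \<partial>lborel)"
      by (rule integral_scaleR_right)
    finally show ?thesis by (simp add: scaleR_conv_of_real)
  qed
  also have "(\<integral>t. (indicator {-pi<..pi} t / (2 * pi)) *\<^sub>R \<phi> t \<partial>lborel) = (\<integral>t. \<phi> t \<partial>ang_meas)"
    unfolding ang_meas_def by (subst integral_density) auto
  also have "\<dots> = (\<integral>t. \<phi> (Arg (rcis r t)) \<partial>ang_meas)"
  proof (intro Bochner_Integration.integral_cong refl)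
    fix t show "\<phi> t = \<phi> (Arg (rcis r t))"
      using rcis_cmod_Arg[of "rcis r t"] r by (simp add: \<phi>_def)
  qed
  also have "\<dots> = (\<integral>w. \<phi> (Arg w) \<partial>ext_prob r)"
  proof -
    have mm: "(\<lambda>w. \<phi> (Arg w)) \<in> borel_measurable (sector_alg r)"
      using measurable_compose[OF Arg_ext_prob m\<phi>, of r]
      by (simp cong: measurable_cong_sets add: sets_ext_prob)
    show ?thesis
      unfolding ext_prob_eq_distr[OF r]
      by (rule integral_distr[OF rcis_measurable[OF r] mm, symmetric])
  qed
  finally show ?thesis by (simp add: \<phi>_def algebra_simps)
qed

definition torus :: "real \<Rightarrow> (complex ^ 'n) set" where
  "torus r = {w. \<forall>\<alpha>. cmod (w $ \<alpha>) = r}"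

lemma compact_torus: "compact (torus r :: (complex ^ 'n) set)"
proof -
  have "closed (torus r :: (complex ^ 'n) set)"
    unfolding torus_def by (intro closed_Collect_all closed_Collect_eq continuous_intros)
  moreover have "norm w \<le> of_nat CARD('n) * r" if "w \<in> torus r" for w :: "complex ^ 'n"
  proof -
    have "norm w \<le> (\<Sum>i\<in>UNIV. norm (w $ i))" unfolding norm_vec_def by (rule L2_set_le_sum) simp
    then show ?thesis using that by (simp add: torus_def)
  qed
  ultimately show ?thesis
    unfolding compact_eq_bounded_closed bounded_iff by blast
qed

context
  fixes r :: real and G :: "complex ^ 'n \<Rightarrow> complex"
  assumes r: "r > 0" and G: "continuous_on (torus r) G"
begin

lemma bound_G: obtains B where "B \<ge> 0" "\<And>w. w \<in> torus r \<Longrightarrow> norm (G w) \<le> B"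
proof -
  have "bounded (G ` torus r)"
    using compact_continuous_image[OF G compact_torus] by (rule compact_imp_bounded)
  then obtain B where "\<forall>x\<in>torus r. norm (G x) \<le> B" unfolding bounded_iff by auto
  then show ?thesis by (intro that[of "max B 0"]) auto
qed

lemma measurable_G:
  fixes \<theta> :: "'b \<Rightarrow> 'n \<Rightarrow> real"
  assumes "\<And>\<beta>. (\<lambda>x. \<theta> x \<beta>) \<in> borel_measurable M"
  shows "(\<lambda>x. G (\<chi> \<beta>. rcis r (\<theta> x \<beta>))) \<in> borel_measurable M"
proof -
  let ?h = "\<lambda>v :: real ^ 'n. G (\<chi> \<beta>. rcis r (v $ \<beta>))"
  have "continuous_on UNIV ?h"
  proof (rule continuous_on_compose2[OF G])
    show "continuous_on UNIV (\<lambda>v :: real ^ 'n. \<chi> \<beta>. rcis r (v $ \<beta>))"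
      unfolding rcis_def cis_conv_exp by (intro continuous_intros)
  qed (use r in \<open>auto simp: torus_def\<close>)
  then have h: "?h \<in> borel_measurable borel" by (rule borel_measurable_continuous_onI)
  have v: "(\<lambda>x. (\<chi> \<beta>. \<theta> x \<beta>) :: real ^ 'n) \<in> borel_measurable M"
  proof (rule borel_measurable_euclidean_space[THEN iffD2], rule ballI)
    fix b :: "real ^ 'n"
    assume "b \<in> Basis"
    then obtain \<beta> where "b = axis \<beta> 1"
      by (auto simp: Basis_vec_def)
    then have "(\<lambda>x. ((\<chi> \<beta>. \<theta> x \<beta>) :: real ^ 'n) \<bullet> b) = (\<lambda>x. \<theta> x \<beta>)"
      by (simp add: inner_axis)
    then show "(\<lambda>x. ((\<chi> \<beta>. \<theta> x \<beta>) :: real ^ 'n) \<bullet> b) \<in> borel_measurable M"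
      using assms[of \<beta>] by simp
  qed
  show ?thesis using measurable_compose[OF v h] by simp
qed

interpretation P: product_sigma_finite "\<lambda>_ :: 'n. ext_prob r"
proof
  interpret p: finite_measure "ext_prob r"
    by standard (simp add: emeasure_ext_prob_space[OF r])
  show "\<exists>A. countable A \<and> A \<subseteq> sets (ext_prob r) \<and> \<Union> A = space (ext_prob r) \<and> (\<forall>a\<in>A. emeasure (ext_prob r) a \<noteq> \<infinity>)"
    by (rule p.sigma_finite_countable)
qed

lemma finite_measure_P: "finite_measure (PiM S (\<lambda>_ :: 'n. ext_prob r))"
proof
  show "emeasure (PiM S (\<lambda>_. ext_prob r)) (space (PiM S (\<lambda>_. ext_prob r))) \<noteq> \<infinity>"
    unfolding space_PiM
    by (subst P.emeasure_PiM) (auto simp: emeasure_ext_prob_space[OF r])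
qed

lemma iterated_contour_eq:
  fixes v :: "complex ^ 'n"
  assumes "distinct xs" "\<And>\<beta>. \<beta> \<notin> set xs \<Longrightarrow> cmod (v $ \<beta>) = r"
  shows "iterated_contour r xs G v = (2 * of_real pi * \<i>) ^ length xs *
    (\<integral>x. G (\<chi> \<beta>. if \<beta> \<in> set xs then rcis r (Arg (x \<beta>)) else v $ \<beta>) *
         (\<Prod>\<alpha>\<in>set xs. rcis r (Arg (x \<alpha>))) \<partial>PiM (set xs) (\<lambda>_. ext_prob r))"
  using assms
proof (induction xs arbitrary: v)
  case Nil
  have "G (\<chi> \<beta>. v $ \<beta>) = G v" by (simp add: vec_nth_inverse)
  interpret finite_measure "PiM {} (\<lambda>_ :: 'n. ext_prob r)" by (rule finite_measure_P)
  show ?case by (simp add: measure_def space_PiM)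
next
  case (Cons \<alpha> xs)
  let ?P = "\<lambda>S :: 'n set. PiM S (\<lambda>_. ext_prob r)"
  define K where "K t x = G (\<chi> \<beta>. rcis r (if \<beta> = \<alpha> then t else if \<beta> \<in> set xs then Arg (x \<beta>) else Arg (v $ \<beta>))) *
     (\<Prod>\<beta>\<in>set xs. rcis r (Arg (x \<beta>)))" for t and x :: "'n \<Rightarrow> complex"
  obtain B where B: "B \<ge> 0" "\<And>w. w \<in> torus r \<Longrightarrow> norm (G w) \<le> B" using bound_G by blast
  have rc[measurable]: "rcis r \<in> borel_measurable borel"
    unfolding rcis_def[abs_def] by (intro borel_measurable_continuous_onI continuous_intros)
  have bK: "norm (K t x) \<le> B * r ^ card (set xs)" for t x
    unfolding K_def norm_mult prod_norm[symmetric] using r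
    by (intro mult_mono B) (auto simp: torus_def)
  have nm: "\<alpha> \<notin> set xs" "distinct xs" using Cons.prems by auto
  have mArg: "(\<lambda>x. Arg (x \<beta>)) \<in> borel_measurable (?P S)" if "\<beta> \<in> S" for \<beta> S
    by (rule measurable_compose[OF measurable_component_singleton[OF that, of "\<lambda>_. ext_prob r"] Arg_ext_prob])
  have mprod: "(\<lambda>x. \<Prod>\<beta>\<in>set xs. rcis r (Arg (x \<beta>))) \<in> borel_measurable (?P S)" if "set xs \<subseteq> S" for S
    using that by (intro borel_measurable_prod measurable_compose[OF mArg rc]) auto
  define H where "H t = (\<integral>x. K t x \<partial>?P (set xs))" for t
  have mK: "(\<lambda>p. K (fst p) (snd p)) \<in> borel_measurable (borel \<Otimes>\<^sub>M ?P (set xs))"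
    unfolding K_def
  proof (intro borel_measurable_times measurable_G)
    show "(\<lambda>p. if \<beta> = \<alpha> then fst p else if \<beta> \<in> set xs then Arg (snd p \<beta>) else Arg (v $ \<beta>))
        \<in> borel_measurable (borel \<Otimes>\<^sub>M ?P (set xs))" for \<beta>
    proof (cases "\<beta> \<noteq> \<alpha> \<and> \<beta> \<in> set xs")
      case True
      then have "(\<lambda>p. Arg (snd p \<beta>)) \<in> borel_measurable (borel \<Otimes>\<^sub>M ?P (set xs))"
        by (intro measurable_compose[OF measurable_snd mArg]) simp
      then show ?thesis using True by simp
    next
      case False
      then show ?thesis by (cases "\<beta> = \<alpha>") simp_all
    qed
    show "(\<lambda>p. \<Prod>\<beta>\<in>set xs. rcis r (Arg (snd p \<beta>))) \<in> borel_measurable (borel \<Otimes>\<^sub>M ?P (set xs))"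
      by (rule measurable_compose[OF measurable_snd mprod]) simp
  qed
  interpret S: finite_measure "?P (set xs)" by (rule finite_measure_P)
  have mH[measurable]: "H \<in> borel_measurable borel"
    unfolding H_def using mK by (intro S.borel_measurable_lebesgue_integral) (simp add: split_beta')
  define C where "C = (\<integral>x. B * r ^ card (set xs) \<partial>?P (set xs))"
  have bH: "norm (H t) \<le> C" for t
  proof -
    have "(\<lambda>x. K t x) \<in> borel_measurable (?P (set xs))"
      using measurable_compose[OF _ mK, of "\<lambda>x. (t, x)"] by simp
    then have "integrable (?P (set xs)) (K t)"
      using bK by (intro S.integrable_const_bound) auto
    then have "norm (H t) \<le> (\<integral>x. norm (K t x) \<partial>?P (set xs))"
      unfolding H_def by (intro integral_norm_bound)
    also have "\<dots> \<le> C"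
      unfolding C_def using bK \<open>integrable _ (K t)\<close> by (intro integral_mono) auto
    finally show ?thesis .
  qed
  have IH: "iterated_contour r xs G (\<chi> \<beta>. if \<beta> = \<alpha> then z else v $ \<beta>) =
      (2 * of_real pi * \<i>) ^ length xs * H (Arg z)" if z: "cmod z = r" for z
  proof -
    have "rcis r (Arg z) = z" using rcis_cmod_Arg[of z] z by simp
    moreover have "rcis r (Arg (v $ \<beta>)) = v $ \<beta>" if "\<beta> \<notin> set xs" "\<beta> \<noteq> \<alpha>" for \<beta>
      using rcis_cmod_Arg[of "v $ \<beta>"] Cons.prems(2)[of \<beta>] that by simp
    ultimately have *: "(\<chi> \<beta>. if \<beta> \<in> set xs then rcis r (Arg (x \<beta>)) else (\<chi> \<beta>. if \<beta> = \<alpha> then z else v $ \<beta>) $ \<beta>)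
       = (\<chi> \<beta>. rcis r (if \<beta> = \<alpha> then Arg z else if \<beta> \<in> set xs then Arg (x \<beta>) else Arg (v $ \<beta>)))" for x :: "'n \<Rightarrow> complex"
      using nm by (auto simp: vec_eq_iff)
    show ?thesis
      by (subst Cons.IH) (use nm Cons.prems z in \<open>auto simp: H_def K_def *\<close>)
  qed
  have vr: "rcis r (Arg (v $ \<beta>)) = v $ \<beta>" if "\<beta> \<notin> set xs" "\<beta> \<noteq> \<alpha>" for \<beta>
    using rcis_cmod_Arg[of "v $ \<beta>"] Cons.prems(2)[of \<beta>] that by simp
  have HA: "H (Arg (rcis r t)) = H t" for t
    using rcis_cmod_Arg[of "rcis r t"] r unfolding H_def K_def
    by (auto simp: if_distrib[of "rcis r"] cong: if_cong)
  have "iterated_contour r (\<alpha> # xs) G v =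
      contour_integral (circlepath 0 r) (\<lambda>z. (2 * of_real pi * \<i>) ^ length xs * H (Arg z))"
    unfolding iterated_contour.simps
    by (intro contour_integral_cong refl IH) (use r in \<open>auto simp: sphere_def\<close>)
  also have "\<dots> = 2 * of_real pi * \<i> * (\<integral>w. (2 * of_real pi * \<i>) ^ length xs * H (Arg (rcis r (Arg w))) * rcis r (Arg w) \<partial>ext_prob r)"
  proof (rule ext_prob_integral[OF r])
    show "(\<lambda>t. (2 * complex_of_real pi * \<i>) ^ length xs * H (Arg (rcis r t))) \<in> borel_measurable borel"
      unfolding HA by measurable
    show "norm ((2 * complex_of_real pi * \<i>) ^ length xs * H (Arg (rcis r t)))
        \<le> norm ((2 * complex_of_real pi * \<i>) ^ length xs) * C" for t
      unfolding HA norm_mult[of _ "H t"] by (intro mult_left_mono bH norm_ge_zero)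
  qed
  also have "\<dots> = (2 * of_real pi * \<i>) ^ Suc (length xs) * (\<integral>w. H (Arg w) * rcis r (Arg w) \<partial>ext_prob r)"
    unfolding HA by (simp add: mult.assoc)
  also have "(\<integral>w. H (Arg w) * rcis r (Arg w) \<partial>ext_prob r) =
    (\<integral>x. G (\<chi> \<beta>. if \<beta> \<in> set (\<alpha> # xs) then rcis r (Arg (x \<beta>)) else v $ \<beta>) *
         (\<Prod>\<alpha>\<in>set (\<alpha> # xs). rcis r (Arg (x \<alpha>))) \<partial>PiM (set (\<alpha> # xs)) (\<lambda>_. ext_prob r))" (is "?L = ?R")
  proof -
    let ?f = "\<lambda>x. K (Arg (x \<alpha>)) x * rcis r (Arg (x \<alpha>))"
    have sets: "set (\<alpha> # xs) = {\<alpha>} \<union> set xs" by simp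
    have int: "integrable (?P ({\<alpha>} \<union> set xs)) ?f"
    proof (rule finite_measure.integrable_const_bound[OF finite_measure_P])
      show "?f \<in> borel_measurable (?P ({\<alpha>} \<union> set xs))"
        unfolding K_def
      proof (intro borel_measurable_times measurable_G)
        show "(\<lambda>x. if \<beta> = \<alpha> then Arg (x \<alpha>) else if \<beta> \<in> set xs then Arg (x \<beta>) else Arg (v $ \<beta>))
            \<in> borel_measurable (?P ({\<alpha>} \<union> set xs))" for \<beta>
        proof (cases "\<beta> \<noteq> \<alpha> \<and> \<beta> \<in> set xs")
          case True
          then show ?thesis using mArg[of \<beta> "{\<alpha>} \<union> set xs"] by simp
        next
          case False
          then show ?thesis using mArg[of \<alpha> "{\<alpha>} \<union> set xs"] by (cases "\<beta> = \<alpha>") simp_all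
        qed
        show "(\<lambda>x. \<Prod>\<beta>\<in>set xs. rcis r (Arg (x \<beta>))) \<in> borel_measurable (?P ({\<alpha>} \<union> set xs))"
          by (rule mprod) auto
        show "(\<lambda>x. rcis r (Arg (x \<alpha>))) \<in> borel_measurable (?P ({\<alpha>} \<union> set xs))"
          by (rule measurable_compose[OF mArg rc]) auto
      qed
      show "AE x in ?P ({\<alpha>} \<union> set xs). norm (?f x) \<le> B * r ^ card (set xs) * r"
        using bK r by (auto simp: norm_mult intro!: mult_right_mono)
    qed
    have "?R = (\<integral>x. ?f x \<partial>?P ({\<alpha>} \<union> set xs))"
      unfolding sets
    proof (intro Bochner_Integration.integral_cong refl)
      fix x
      have "(\<chi> \<beta>. if \<beta> \<in> {\<alpha>} \<union> set xs then rcis r (Arg (x \<beta>)) else v $ \<beta>) =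
         (\<chi> \<beta>. rcis r (if \<beta> = \<alpha> then Arg (x \<alpha>) else if \<beta> \<in> set xs then Arg (x \<beta>) else Arg (v $ \<beta>)))"
        using vr by (auto simp: vec_eq_iff)
      then show "G (\<chi> \<beta>. if \<beta> \<in> {\<alpha>} \<union> set xs then rcis r (Arg (x \<beta>)) else v $ \<beta>) *
         (\<Prod>\<alpha>\<in>{\<alpha>} \<union> set xs. rcis r (Arg (x \<alpha>))) = ?f x"
        using nm by (simp add: K_def mult_ac)
    qed
    also have "\<dots> = (\<integral>x. (\<integral>y. ?f (merge {\<alpha>} (set xs) (x, y)) \<partial>?P (set xs)) \<partial>?P {\<alpha>})"
      by (rule P.product_integral_fold) (use nm int in auto)
    also have "\<dots> = (\<integral>x. H (Arg (x \<alpha>)) * rcis r (Arg (x \<alpha>)) \<partial>?P {\<alpha>})"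
    proof (intro Bochner_Integration.integral_cong refl)
      fix x :: "'n \<Rightarrow> complex"
      have "?f (merge {\<alpha>} (set xs) (x, y)) = K (Arg (x \<alpha>)) y * rcis r (Arg (x \<alpha>))" for y
        unfolding K_def using nm
        by (intro arg_cong2[where f = "(*)"] arg_cong[where f = G] prod.cong) (auto simp: merge_def vec_eq_iff)
      then show "(\<integral>y. ?f (merge {\<alpha>} (set xs) (x, y)) \<partial>?P (set xs)) = H (Arg (x \<alpha>)) * rcis r (Arg (x \<alpha>))"
        by (simp add: H_def)
    qed
    also have "\<dots> = ?L"
      by (rule P.product_integral_singleton) measurable
    finally show ?thesis by simp
  qed
  finally show ?case by simp
qed

end

lemma integral_ext_prob_n:
  fixes F :: "complex ^ ('n :: {finite, linorder}) \<Rightarrow> complex"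
  assumes r: "r > 0" and F: "continuous_on (torus r) F"
  shows "(\<lambda>w. F (to_torus r w)) \<in> borel_measurable (ext_prob_n r)"
    and "lens_integral r F =
      1 / (2 * complex_of_real pi * \<i>) ^ CARD('n) * torus_contour r (\<lambda>w. F w / (\<Prod>\<mu>\<in>UNIV. w $ \<mu>))"
proof -
  let ?P = "PiM (UNIV :: 'n set) (\<lambda>_. ext_prob r)"
  let ?G = "\<lambda>w :: (complex, 'n) vec. F w / (\<Prod>\<mu>\<in>UNIV. w $ \<mu>)"
  have inj: "inj (vec_lambda :: ('n \<Rightarrow> complex) \<Rightarrow> (complex, 'n) vec)"
    by (metis injI vec_lambda_inverse UNIV_I)
  have G: "continuous_on (torus r) ?G"
    using r by (intro continuous_intros F) (auto simp: torus_def)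
  have "(\<lambda>x :: 'n \<Rightarrow> complex. F (\<chi> \<beta>. rcis r (Arg (x \<beta>)))) \<in> borel_measurable ?P"
    by (rule measurable_G[OF r F]) measurable
  then show m: "(\<lambda>w. F (to_torus r w)) \<in> borel_measurable (ext_prob_n r)"
    unfolding ext_prob_n_def to_torus_def by (intro measurable_embed_measure1) simp
  have "lens_integral r F = (\<integral>x. F (to_torus r (vec_lambda x)) \<partial>?P)"
    using m unfolding lens_integral_def ext_prob_n_def
    by (subst embed_measure_eq_distr[OF inj], subst integral_distr)
       (auto intro: measurable_embed_measure2[OF inj] simp: embed_measure_eq_distr[OF inj, symmetric])
  also have "\<dots> = (\<integral>x. ?G (\<chi> \<beta>. if \<beta> \<in> UNIV then rcis r (Arg (x \<beta>)) else 0 $ \<beta>) *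
      (\<Prod>\<mu>\<in>UNIV. rcis r (Arg (x \<mu>))) \<partial>?P)"
    using r by (intro Bochner_Integration.integral_cong) (auto simp: to_torus_def)
  finally show "lens_integral r F =
      1 / (2 * complex_of_real pi * \<i>) ^ CARD('n) * torus_contour r ?G"
    using iterated_contour_eq[OF r G, of "sorted_list_of_set UNIV" 0]
    by (simp add: torus_contour_def)
qed


section \<open>Functions of several complex variables\<close>

definition polydisc :: "real \<Rightarrow> (complex ^ 'n) set" where
  "polydisc R = {w. \<forall>\<beta>. cmod (w $ \<beta>) < R}"

definition off_axes :: "(complex ^ 'n) set" where
  "off_axes = {w. \<forall>\<beta>. w $ \<beta> \<noteq> 0}"

definition holomorphic_mv :: "(complex ^ 'n \<Rightarrow> complex) \<Rightarrow> (complex ^ 'n) set \<Rightarrow> bool" where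
  "holomorphic_mv h S \<longleftrightarrow>
     (\<forall>w\<in>S. \<exists>L. (h has_derivative L) (at w within S) \<and> (\<forall>c v. L (c *s v) = c * L v))"

text \<open>Values at points where the denominator vanishes (poles and indeterminacies) are unconstrained.\<close>

definition meromorphic_mv :: "(complex ^ 'n \<Rightarrow> complex) \<Rightarrow> (complex ^ 'n) set \<Rightarrow> bool" where
  "meromorphic_mv f S \<longleftrightarrow>
     (\<forall>p\<in>S. \<exists>e>0. \<exists>g q. holomorphic_mv g (ball p e) \<and> holomorphic_mv q (ball p e) \<and>
        (\<exists>w\<in>ball p e. q w \<noteq> 0) \<and> (\<forall>w\<in>ball p e. q w \<noteq> 0 \<longrightarrow> f w = g w / q w))"

text \<open>For \<open>n \<ge> 2\<close> poles are never isolated points. A pole at \<open>0\<close> of order at most \<open>1\<close> is one with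
  principal part \<open>\<Sum>\<^sub>\<beta> c\<^sub>\<beta> / w\<^sub>\<beta>\<close>; no other pole meets the polydisc of radius \<open>R\<close>. For \<open>n = 1\<close> this
  says that \<open>f\<close> is holomorphic in the punctured disc, with at most a simple pole at \<open>0\<close>.\<close>

definition single_pole_at_0 :: "real \<Rightarrow> (complex ^ 'n \<Rightarrow> complex ^ 'k) \<Rightarrow> bool" where
  "single_pole_at_0 R f \<longleftrightarrow>
     (\<exists>(c :: 'n \<Rightarrow> complex ^ 'k) h. (\<forall>\<alpha>. holomorphic_mv (\<lambda>w. h w $ \<alpha>) (polydisc R)) \<and>
        (\<forall>w \<in> polydisc R \<inter> off_axes. f w = (\<Sum>\<beta>\<in>UNIV. (1 / w $ \<beta>) *s c \<beta>) + h w))"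

definition lens_functions :: "(complex ^ 'n \<Rightarrow> complex ^ 'k) set" where
  "lens_functions = {f. (\<forall>\<alpha>. meromorphic_mv (\<lambda>w. f w $ \<alpha>) UNIV) \<and>
     (\<exists>R>0. single_pole_at_0 R f) \<and> (\<forall>r>0. lens_measurable r f)}"


section \<open>Decomposition\<close>

definition core_component :: "real \<Rightarrow> (complex ^ ('n :: {finite, linorder}) \<Rightarrow> complex ^ 'k) \<Rightarrow> complex ^ 'k" where
  "core_component r f = (\<chi> \<alpha>. 1 / (2 * complex_of_real pi * \<i>) ^ CARD('n) *
     torus_contour r (\<lambda>w. f w $ \<alpha> / (\<Prod>\<mu>\<in>UNIV. w $ \<mu>)))"

definition residue_matrix ::
    "real \<Rightarrow> (complex ^ ('n :: {finite, linorder}) \<Rightarrow> complex ^ 'k) \<Rightarrow> complex ^ ('n :: {finite, linorder}) ^ 'k" where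
  "residue_matrix r f = (\<chi> \<alpha> \<beta>. 1 / (2 * complex_of_real pi * \<i>) ^ CARD('n) *
     torus_contour r (\<lambda>w. f w $ \<alpha> / (\<Prod>\<mu>\<in>UNIV - {\<beta>}. w $ \<mu>)))"

definition principal_component ::
    "real \<Rightarrow> (complex ^ ('n :: {finite, linorder}) \<Rightarrow> complex ^ 'k) \<Rightarrow> complex ^ ('n :: {finite, linorder}) \<Rightarrow> complex ^ 'k" where
  "principal_component r f w = (\<chi> \<alpha>. \<Sum>\<beta>\<in>UNIV. residue_matrix r f $ \<alpha> $ \<beta> / w $ \<beta>)"

text \<open>The limit extends \<open>f - f\<^sub>0 - f\<^sub>P\<close> across its removable singularities on the coordinate
  hyperplanes, in particular to \<open>0\<close>.\<close>

definition analytic_component ::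
    "real \<Rightarrow> (complex ^ ('n :: {finite, linorder}) \<Rightarrow> complex ^ 'k) \<Rightarrow> complex ^ ('n :: {finite, linorder}) \<Rightarrow> complex ^ 'k" where
  "analytic_component r f w =
     Lim (at w within off_axes) (\<lambda>v. f v - core_component r f - principal_component r f v)"

definition jacobian_at_0 ::
    "real \<Rightarrow> (complex ^ ('n :: {finite, linorder}) \<Rightarrow> complex ^ 'k) \<Rightarrow> complex ^ ('n :: {finite, linorder}) ^ 'k" where
  "jacobian_at_0 r f = (\<chi> \<alpha> \<beta>. deriv (\<lambda>z. analytic_component r f (axis \<beta> z) $ \<alpha>) 0)"

definition higher_order ::
    "real \<Rightarrow> (complex ^ ('n :: {finite, linorder}) \<Rightarrow> complex ^ 'k) \<Rightarrow> complex ^ ('n :: {finite, linorder}) \<Rightarrow> complex ^ 'k" where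
  "higher_order r f w = analytic_component r f w - jacobian_at_0 r f *v w"

definition conj_transpose :: "complex ^ 'm ^ 'l \<Rightarrow> complex ^ 'l ^ 'm" where
  "conj_transpose A = (\<chi> i j. cnj (A $ j $ i))"

end

theory Submission
  imports Defs
begin

text \<open>On the torus the mean of a holomorphic \<open>F\<close> is \<open>F(0)\<close> and the mean of \<open>F(w) / w\<^sub>\<beta>\<close> is
  \<open>\<partial>\<^sub>\<beta>F(0)\<close>, while the conjugate of \<open>w\<^sub>\<beta>\<close> is \<open>r\<^sup>2 / w\<^sub>\<beta>\<close>. Hence the principal part, the
  constant, the linear part and the remainder of \<open>f\<close> are pairwise orthogonal, and Pythagoras gives
  the variance. Applying the Schwarz lemma twice on complex lines through \<open>0\<close> bounds the remainder by
  \<open>C r\<^sup>2\<close> on the torus, so that its square contributes \<open>O(r\<^sup>4)\<close>.\<close>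

no_notation fps_nth (infixl \<open>$\<close> 75)

section \<open>Holomorphic functions on a polydisc\<close>

text \<open>No power series in several variables is used. Pairing with the conjugate of a coordinate
  reduces to a mean of \<open>F w / w $ \<beta>\<close>, which is a derivative of a one-variable
  function on a coordinate axis. So the linear part is orthogonal to the remainder as soon as the
  axis derivatives of the remainder vanish. An iterated contour integral fixes the order of the
  coordinates, whereas this mean is easiest with the coordinate \<beta> outermost; the detour
  through the product measure frees the order. The function f is prescribed only where no coordinate
  vanishes. This is harmless on a torus, but for n \<ge> 2 the coordinate axes lie entirely in the
  excluded set, so first-order data must be read off the holomorphic part h, which is reached by a
  limit. The coefficients are taken at a radius s and the variance at a radius r. The two fit
  together because every coefficient turns out to depend only on the pole coefficients c and on
  h.\<close>

lemma open_polydisc: "open (polydisc R :: (complex ^ 'n) set)"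
proof -
  have "polydisc R = (\<Inter>\<beta>. {w :: complex ^ 'n. cmod (w $ \<beta>) < R})"
    by (auto simp: polydisc_def)
  then show ?thesis
    by (auto intro!: open_INT open_Collect_less continuous_intros)
qed

lemma torus_subset_polydisc: "r < R \<Longrightarrow> torus r \<subseteq> polydisc R"
  by (auto simp: torus_def polydisc_def)

lemma torus_nonzero: "0 < r \<Longrightarrow> w \<in> torus r \<Longrightarrow> w $ \<beta> \<noteq> 0"
  by (auto simp: torus_def)

lemma cnj_torus: "0 < r \<Longrightarrow> w \<in> torus r \<Longrightarrow> cnj (w $ \<beta>) = (of_real r)\<^sup>2 / w $ \<beta>"
  using torus_nonzero[of r w \<beta>] complex_norm_square[of "w $ \<beta>"]
  by (simp add: torus_def field_simps)

lemma holomorphic_mv_continuous_on: "holomorphic_mv F S \<Longrightarrow> continuous_on S F"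
  unfolding holomorphic_mv_def continuous_on_eq_continuous_within
  using has_derivative_continuous by blast

lemma holomorphic_mv_const: "holomorphic_mv (\<lambda>w. c) S"
  unfolding holomorphic_mv_def by (auto intro!: exI[of _ "\<lambda>v. 0"] derivative_intros)

lemma holomorphic_mv_coord: "holomorphic_mv (\<lambda>w. w $ \<beta>) S"
  unfolding holomorphic_mv_def
  by (auto intro!: exI[of _ "\<lambda>v. v $ \<beta>"] bounded_linear_imp_has_derivative bounded_linear_vec_nth)

lemma holomorphic_mv_add:
  assumes "holomorphic_mv F S" "holomorphic_mv G S"
  shows "holomorphic_mv (\<lambda>w. F w + G w) S"
  unfolding holomorphic_mv_def
proof
  fix w assume w: "w \<in> S"
  obtain L where L: "(F has_derivative L) (at w within S)" "\<And>c v. L (c *s v) = c * L v"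
    using assms(1) w unfolding holomorphic_mv_def by blast
  obtain K where K: "(G has_derivative K) (at w within S)" "\<And>c v. K (c *s v) = c * K v"
    using assms(2) w unfolding holomorphic_mv_def by blast
  show "\<exists>L. ((\<lambda>w. F w + G w) has_derivative L) (at w within S) \<and> (\<forall>c v. L (c *s v) = c * L v)"
    using has_derivative_add[OF L(1) K(1)]
    by (intro exI[of _ "\<lambda>v. L v + K v"]) (auto simp: L(2) K(2) algebra_simps)
qed

lemma holomorphic_mv_mult:
  assumes "holomorphic_mv F S" "holomorphic_mv G S"
  shows "holomorphic_mv (\<lambda>w. F w * G w) S"
  unfolding holomorphic_mv_def
proof
  fix w assume w: "w \<in> S"
  obtain L where L: "(F has_derivative L) (at w within S)" "\<And>c v. L (c *s v) = c * L v"
    using assms(1) w unfolding holomorphic_mv_def by blast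
  obtain K where K: "(G has_derivative K) (at w within S)" "\<And>c v. K (c *s v) = c * K v"
    using assms(2) w unfolding holomorphic_mv_def by blast
  show "\<exists>L. ((\<lambda>w. F w * G w) has_derivative L) (at w within S) \<and> (\<forall>c v. L (c *s v) = c * L v)"
    using has_derivative_mult[OF L(1) K(1)]
    by (intro exI[of _ "\<lambda>v. F w * K v + L v * G w"]) (auto simp: L(2) K(2) algebra_simps)
qed

lemma holomorphic_mv_sum:
  "(\<And>i. i \<in> I \<Longrightarrow> holomorphic_mv (F i) S) \<Longrightarrow> holomorphic_mv (\<lambda>w. \<Sum>i\<in>I. F i w) S"
  by (induction I rule: infinite_finite_induct) (auto intro: holomorphic_mv_const holomorphic_mv_add)

lemma holomorphic_mv_diff:
  assumes "holomorphic_mv F S" "holomorphic_mv G S"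
  shows "holomorphic_mv (\<lambda>w. F w - G w) S"
  using holomorphic_mv_add[OF assms(1) holomorphic_mv_mult[OF holomorphic_mv_const[of "-1"] assms(2)]]
  by simp

lemmas holomorphic_mv_intros = holomorphic_mv_const holomorphic_mv_coord holomorphic_mv_add
  holomorphic_mv_diff holomorphic_mv_mult holomorphic_mv_sum

text \<open>The chain rule gives the real derivative \<open>\<lambda>z. L (z *s q)\<close>; complex
  homogeneity of L turns it into multiplication by \<open>L q\<close>, which is a complex
  derivative.\<close>

lemma has_field_derivative_along_line:
  fixes F :: "complex ^ 'n \<Rightarrow> complex"
  assumes "(F has_derivative L) (at (p + z *s q))" "\<And>c v. L (c *s v) = c * L v"
  shows "((\<lambda>z. F (p + z *s q)) has_field_derivative L q) (at z)"
proof -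
  have "linear (\<lambda>z. z *s q)"
    by (rule linearI) (auto simp: vec_eq_iff algebra_simps)
  then have "((\<lambda>z. p + z *s q) has_derivative (\<lambda>z. z *s q)) (at z)"
    by (auto intro!: derivative_eq_intros bounded_linear_imp_has_derivative
        simp: linear_conv_bounded_linear)
  from diff_chain_at[OF this assms(1)]
  show ?thesis by (simp add: has_field_derivative_def o_def assms(2) mult_commute_abs)
qed

lemma holomorphic_mv_line:
  fixes F :: "complex ^ 'n \<Rightarrow> complex"
  assumes "holomorphic_mv F (polydisc R)" "\<And>z. z \<in> A \<Longrightarrow> p + z *s q \<in> polydisc R" "open A"
  shows "(\<lambda>z. F (p + z *s q)) holomorphic_on A"
  unfolding holomorphic_on_open[OF assms(3)]
proof
  fix z assume "z \<in> A"
  then obtain L where "(F has_derivative L) (at (p + z *s q))" "\<And>c v. L (c *s v) = c * L v"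
    using assms(1,2) at_within_open[OF _ open_polydisc] unfolding holomorphic_mv_def by metis
  then show "\<exists>D. ((\<lambda>z. F (p + z *s q)) has_field_derivative D) (at z)"
    using has_field_derivative_along_line by blast
qed

text \<open>Varying one coordinate is motion along an affine complex line. The coordinate \<alpha>
  of v is overwritten, so only the other coordinates have to lie in the disc.\<close>

lemma holomorphic_mv_update:
  fixes F :: "complex ^ 'n \<Rightarrow> complex"
  assumes "holomorphic_mv F (polydisc R)" "\<And>\<beta>. \<beta> \<noteq> \<alpha> \<Longrightarrow> cmod (v $ \<beta>) < R"
  shows "(\<lambda>z. F (\<chi> \<beta>. if \<beta> = \<alpha> then z else v $ \<beta>)) holomorphic_on ball 0 R"
proof -
  define p where "p = (\<chi> \<beta>. if \<beta> = \<alpha> then 0 else v $ \<beta>)"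
  have eq: "(\<chi> \<beta>. if \<beta> = \<alpha> then z else v $ \<beta>) = p + z *s axis \<alpha> 1" for z
    by (auto simp: p_def vec_eq_iff axis_def)
  have "p + z *s axis \<alpha> 1 \<in> polydisc R" if "z \<in> ball 0 R" for z
    using that assms(2) unfolding eq[symmetric] by (auto simp: polydisc_def)
  then show ?thesis
    unfolding eq by (intro holomorphic_mv_line[OF assms(1)]) auto
qed

text \<open>The derivative at 0 is complex linear, so the axis derivatives determine it in every
  direction. In particular, if they vanish, F has vanishing derivative along every line through 0,
  as the Schwarz argument for the remainder needs.\<close>

lemma has_field_derivative_line_0:
  fixes F :: "complex ^ 'n \<Rightarrow> complex"
  assumes "holomorphic_mv F (polydisc R)" "0 < R"
  shows "((\<lambda>z. F (z *s u)) has_field_derivative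
    (\<Sum>\<beta>\<in>UNIV. u $ \<beta> * deriv (\<lambda>z. F (axis \<beta> z)) 0)) (at 0)"
proof -
  have 0: "0 \<in> polydisc R" using assms(2) by (simp add: polydisc_def)
  obtain L where L: "(F has_derivative L) (at 0)" "\<And>c v. L (c *s v) = c * L v"
    using assms(1) 0 at_within_open[OF 0 open_polydisc] unfolding holomorphic_mv_def by metis
  have d: "((\<lambda>z. F (z *s q)) has_field_derivative L q) (at 0)" for q
    using has_field_derivative_along_line[of F L 0 0 q] L by simp
  have ax: "z *s axis \<beta> 1 = axis \<beta> z" for z :: complex and \<beta> :: 'n
    by (auto simp: vec_eq_iff axis_def)
  have "deriv (\<lambda>z. F (axis \<beta> z)) 0 = L (axis \<beta> 1)" for \<beta>
    using DERIV_imp_deriv[OF d[of "axis \<beta> 1"]] by (simp add: ax)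
  moreover have "L u = (\<Sum>\<beta>\<in>UNIV. u $ \<beta> * L (axis \<beta> 1))"
  proof -
    have "L (\<Sum>\<beta>\<in>UNIV. u $ \<beta> *s axis \<beta> 1) = (\<Sum>\<beta>\<in>UNIV. L (u $ \<beta> *s axis \<beta> 1))"
      by (rule linear_sum) (rule has_derivative_linear[OF L(1)])
    then show ?thesis by (simp only: basis_expansion L(2))
  qed
  ultimately show ?thesis using d[of u] by simp
qed

lemma field_differentiable_axis:
  fixes F :: "complex ^ 'n \<Rightarrow> complex"
  assumes "holomorphic_mv F (polydisc R)" "0 < R"
  shows "(\<lambda>z. F (axis \<beta> z)) field_differentiable at 0"
proof -
  have ax: "z *s axis \<beta> 1 = axis \<beta> z" for z :: complex
    by (auto simp: vec_eq_iff axis_def)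
  show ?thesis
    using has_field_derivative_line_0[OF assms, of "axis \<beta> 1"]
    unfolding ax field_differentiable_def by blast
qed

section \<open>Means over the torus\<close>

text \<open>The hypothesis asks for agreement only at points that the integration visits:
  coordinates in \<open>xs\<close> on the circle, all others frozen at v. The freezing is what later
  allows an outer variable to be treated as a constant.\<close>

lemma iterated_contour_cong:
  assumes "0 \<le> r"
    and "\<And>w. (\<And>\<beta>. \<beta> \<in> set xs \<Longrightarrow> cmod (w $ \<beta>) = r) \<Longrightarrow>
      (\<And>\<beta>. \<beta> \<notin> set xs \<Longrightarrow> w $ \<beta> = v $ \<beta>) \<Longrightarrow> F w = G w"
  shows "iterated_contour r xs F v = iterated_contour r xs G v"
  using assms(2)
proof (induction xs arbitrary: v)
  case (Cons \<alpha> xs)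
  have "iterated_contour r xs F (\<chi> \<beta>. if \<beta> = \<alpha> then z else v $ \<beta>) =
        iterated_contour r xs G (\<chi> \<beta>. if \<beta> = \<alpha> then z else v $ \<beta>)"
    if z: "cmod z = r" for z
  proof (rule Cons.IH)
    fix w :: "(complex, 'a) vec"
    assume w: "\<And>\<beta>. \<beta> \<in> set xs \<Longrightarrow> cmod (w $ \<beta>) = r"
      "\<And>\<beta>. \<beta> \<notin> set xs \<Longrightarrow> w $ \<beta> = (\<chi> \<beta>. if \<beta> = \<alpha> then z else v $ \<beta>) $ \<beta>"
    show "F w = G w"
    proof (rule Cons.prems)
      fix \<beta>
      show "cmod (w $ \<beta>) = r" if "\<beta> \<in> set (\<alpha> # xs)"
        using that w(1)[of \<beta>] w(2)[of \<beta>] z by (cases "\<beta> \<in> set xs") auto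
      show "w $ \<beta> = v $ \<beta>" if "\<beta> \<notin> set (\<alpha> # xs)"
        using that w(2)[of \<beta>] by auto
    qed
  qed
  then show ?case
    using assms(1) by (auto intro!: contour_integral_cong)
qed simp

text \<open>Cauchy's formula, one coordinate at a time: each integration sets its coordinate to 0
  and contributes a factor \<open>2 * of_real pi * \<i>\<close>.\<close>

lemma iterated_contour_holomorphic:
  fixes F :: "complex ^ 'n \<Rightarrow> complex"
  assumes "holomorphic_mv F (polydisc R)" "0 < r" "r < R" "distinct xs" "v \<in> polydisc R"
  shows "iterated_contour r xs (\<lambda>w. F w / (\<Prod>\<mu>\<in>set xs. w $ \<mu>)) v =
    (2 * of_real pi * \<i>) ^ length xs * F (\<chi> \<beta>. if \<beta> \<in> set xs then 0 else v $ \<beta>)"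
  using assms(1,4,5)
proof (induction xs arbitrary: F v)
  case Nil
  then show ?case by (simp add: vec_nth_inverse)
next
  case (Cons \<alpha> xs)
  let ?upd = "\<lambda>z. \<chi> \<beta>. if \<beta> = \<alpha> then z else v $ \<beta>"
  let ?v0 = "\<chi> \<beta>. if \<beta> \<in> set xs then 0 else v $ \<beta>"
  let ?g = "\<lambda>z. (2 * of_real pi * \<i>) ^ length xs * F (\<chi> \<beta>. if \<beta> = \<alpha> then z else ?v0 $ \<beta>)"
  have nm: "\<alpha> \<notin> set xs" "distinct xs" using Cons.prems by auto
  have "iterated_contour r xs (\<lambda>w. F w / (\<Prod>\<mu>\<in>set (\<alpha> # xs). w $ \<mu>)) (?upd z) = ?g z / (z - 0)"
    if z: "cmod z = r" for z
  proof -
    \<comment> \<open>While the coordinates of \<open>xs\<close> are integrated, the coordinate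
      \<alpha> stays at z. The factor 1/z is therefore absorbed into the holomorphic function, which
      is why the induction generalizes over F.\<close>
    have "iterated_contour r xs (\<lambda>w. F w / (\<Prod>\<mu>\<in>set (\<alpha> # xs). w $ \<mu>)) (?upd z) =
      iterated_contour r xs (\<lambda>w. inverse z * F w / (\<Prod>\<mu>\<in>set xs. w $ \<mu>)) (?upd z)"
      using nm assms(2) by (intro iterated_contour_cong) (auto simp: field_simps)
    also have "\<dots> = (2 * of_real pi * \<i>) ^ length xs *
        (inverse z * F (\<chi> \<beta>. if \<beta> \<in> set xs then 0 else ?upd z $ \<beta>))"
      using nm Cons.prems z assms(3)
      by (intro Cons.IH holomorphic_mv_intros) (auto simp: polydisc_def)
    also have "(\<chi> \<beta>. if \<beta> \<in> set xs then 0 else ?upd z $ \<beta>) = (\<chi> \<beta>. if \<beta> = \<alpha> then z else ?v0 $ \<beta>)"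
      using nm by (auto simp: vec_eq_iff)
    finally show ?thesis by (simp add: field_simps)
  qed
  then have "iterated_contour r (\<alpha> # xs) (\<lambda>w. F w / (\<Prod>\<mu>\<in>set (\<alpha> # xs). w $ \<mu>)) v =
      contour_integral (circlepath 0 r) (\<lambda>z. ?g z / (z - 0))"
    unfolding iterated_contour.simps
    using assms(2) by (intro contour_integral_cong refl) auto
  also have "\<dots> = 2 * of_real pi * \<i> * ?g 0"
  proof (rule contour_integral_unique, rule Cauchy_integral_circlepath_simple)
    have "?g holomorphic_on ball 0 R"
      using Cons.prems assms(2,3)
      by (intro holomorphic_intros holomorphic_mv_update) (auto simp: polydisc_def)
    then show "?g holomorphic_on cball 0 r"
      by (rule holomorphic_on_subset) (use assms(3) in auto)
  qed (use assms(2) in simp)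
  also have "(\<chi> \<beta>. if \<beta> = \<alpha> then 0 else ?v0 $ \<beta>) = (\<chi> \<beta>. if \<beta> \<in> set (\<alpha> # xs) then 0 else v $ \<beta>)"
    by (auto simp: vec_eq_iff)
  finally show ?case by simp
qed

lemma to_torus_mem: "0 < r \<Longrightarrow> to_torus r w \<in> torus r"
  by (simp add: to_torus_def torus_def)

lemma lens_integral_cong:
  assumes "0 < r" "\<And>w. w \<in> torus r \<Longrightarrow> F w = G w"
  shows "lens_integral r F = lens_integral r G"
  unfolding lens_integral_def using assms by (simp add: to_torus_mem)

lemma torus_contour_cong:
  assumes "0 < r" "\<And>w. w \<in> torus r \<Longrightarrow> F w = G w"
  shows "torus_contour r F = torus_contour r G"
  unfolding torus_contour_def
  using assms by (intro iterated_contour_cong) (auto simp: torus_def)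

text \<open>The iterated contour integral does not depend on the order of the coordinates, so that any
  chosen coordinate may be integrated last.\<close>

lemma lens_integral_eq_iterated_contour:
  fixes F :: "complex ^ ('n :: {finite, linorder}) \<Rightarrow> complex"
  assumes r: "r > 0" and F: "continuous_on (torus r) F" and xs: "distinct xs" "set xs = UNIV"
  shows "lens_integral r F = 1 / (2 * complex_of_real pi * \<i>) ^ CARD('n) *
    iterated_contour r xs (\<lambda>w. F w / (\<Prod>\<mu>\<in>UNIV. w $ \<mu>)) 0"
proof -
  have G: "continuous_on (torus r) (\<lambda>w. F w / (\<Prod>\<mu>\<in>UNIV. w $ \<mu>))"
    using torus_nonzero[OF r] by (intro continuous_intros F) auto
  show ?thesis
    unfolding integral_ext_prob_n(2)[OF r F] torus_contour_def
    using iterated_contour_eq[OF r G, of xs 0] iterated_contour_eq[OF r G, of "sorted_list_of_set UNIV" 0]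
      xs distinct_card[OF xs(1)] by simp
qed

context
  fixes F :: "complex ^ ('n :: {finite, linorder}) \<Rightarrow> complex" and r R :: real
  assumes r: "0 < r" "r < R" and F: "holomorphic_mv F (polydisc R)"
begin

lemma holomorphic_mv_continuous_on_torus: "continuous_on (torus r) F"
  using holomorphic_mv_continuous_on[OF F] torus_subset_polydisc[OF r(2)]
  by (rule continuous_on_subset)

lemma lens_integral_holomorphic: "lens_integral r F = F 0"
proof -
  let ?xs = "sorted_list_of_set (UNIV :: 'n set)"
  have "iterated_contour r ?xs (\<lambda>w. F w / (\<Prod>\<mu>\<in>set ?xs. w $ \<mu>)) 0 =
      (2 * of_real pi * \<i>) ^ length ?xs * F (\<chi> \<beta>. if \<beta> \<in> set ?xs then 0 else 0 $ \<beta>)"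
    using r by (intro iterated_contour_holomorphic[OF F]) (auto simp: polydisc_def)
  moreover have "(\<chi> \<beta>. 0) = (0 :: (complex, 'n) vec)" by (simp add: vec_eq_iff)
  ultimately show ?thesis
    using lens_integral_eq_iterated_contour[OF r(1) holomorphic_mv_continuous_on_torus, of ?xs] by simp
qed

text \<open>With \<beta> at the head of the list its contour is outermost. The inner integrations
  set all other coordinates to 0, and what remains is Cauchy's formula for the first derivative of a
  function of one variable.\<close>

lemma lens_integral_holomorphic_divide_coord:
  "lens_integral r (\<lambda>w. F w / w $ \<beta>) = deriv (\<lambda>z. F (axis \<beta> z)) 0"
proof -
  obtain xs where xs: "distinct xs" "set xs = UNIV - {\<beta>}"
    using finite_distinct_list[of "UNIV - {\<beta>}"] by auto
  have set: "set (\<beta> # xs) = UNIV" using xs by auto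
  let ?upd = "\<lambda>z :: complex. (\<chi> \<gamma>. if \<gamma> = \<beta> then z else 0 $ \<gamma>) :: (complex, 'n) vec"
  have upd: "?upd z = axis \<beta> z" for z
    by (auto simp: vec_eq_iff axis_def)
  let ?g = "\<lambda>z. (2 * of_real pi * \<i>) ^ length xs * F (axis \<beta> z)"
  \<comment> \<open>The exponent 2 combines one factor from the weight of the mean with one from the
    extra division by \<open>w $ \<beta>\<close>. It is written \<open>Suc 1\<close> to fit the
    Cauchy formula for the derivative of order 1.\<close>
  have inner: "iterated_contour r xs (\<lambda>w. F w / w $ \<beta> / (\<Prod>\<mu>\<in>UNIV. w $ \<mu>)) (?upd z) = ?g z / (z - 0) ^ Suc 1"
    if z: "cmod z = r" for z
  proof -
    have "iterated_contour r xs (\<lambda>w. F w / w $ \<beta> / (\<Prod>\<mu>\<in>UNIV. w $ \<mu>)) (?upd z) =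
      iterated_contour r xs (\<lambda>w. inverse (z * z) * F w / (\<Prod>\<mu>\<in>set xs. w $ \<mu>)) (?upd z)"
    proof (rule iterated_contour_cong)
      fix w :: "(complex, 'n) vec"
      assume w: "\<And>\<gamma>. \<gamma> \<notin> set xs \<Longrightarrow> w $ \<gamma> = ?upd z $ \<gamma>"
      have "w $ \<beta> = z" using w[of \<beta>] xs by simp
      moreover have "(\<Prod>\<mu>\<in>UNIV. w $ \<mu>) = w $ \<beta> * (\<Prod>\<mu>\<in>set xs. w $ \<mu>)"
        unfolding xs(2) by (rule prod.remove) auto
      ultimately show "F w / w $ \<beta> / (\<Prod>\<mu>\<in>UNIV. w $ \<mu>) =
          inverse (z * z) * F w / (\<Prod>\<mu>\<in>set xs. w $ \<mu>)"
        by (simp only:) (simp add: divide_inverse mult_ac)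
    qed (use r in simp)
    also have "\<dots> = (2 * of_real pi * \<i>) ^ length xs *
        (inverse (z * z) * F (\<chi> \<gamma>. if \<gamma> \<in> set xs then 0 else ?upd z $ \<gamma>))"
    proof (rule iterated_contour_holomorphic)
      show "holomorphic_mv (\<lambda>w. inverse (z * z) * F w) (polydisc R)"
        by (intro holomorphic_mv_intros F)
      show "?upd z \<in> polydisc R" using z r by (simp add: polydisc_def)
    qed (use xs r in simp_all)
    also have "(\<chi> \<gamma>. if \<gamma> \<in> set xs then 0 else ?upd z $ \<gamma>) = axis \<beta> z"
      using xs by (auto simp: vec_eq_iff axis_def)
    finally show ?thesis using z r by (simp add: field_simps)
  qed
  have g: "?g holomorphic_on ball 0 R"
    using r holomorphic_mv_update[OF F, where v = 0 and \<alpha> = \<beta>]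
    by (intro holomorphic_intros) (auto simp: upd)
  have cont: "continuous_on (torus r) (\<lambda>w. F w / w $ \<beta>)"
    using torus_nonzero[OF r(1)]
    by (intro continuous_intros holomorphic_mv_continuous_on_torus) auto
  have "iterated_contour r (\<beta> # xs) (\<lambda>w. F w / w $ \<beta> / (\<Prod>\<mu>\<in>UNIV. w $ \<mu>)) 0 =
      contour_integral (circlepath 0 r) (\<lambda>z. ?g z / (z - 0) ^ Suc 1)"
    unfolding iterated_contour.simps
    using r inner by (intro contour_integral_cong refl) auto
  also have "\<dots> = of_real (2 * pi) * \<i> / fact 1 * (deriv ^^ 1) ?g 0"
    by (rule contour_integral_unique, rule Cauchy_has_contour_integral_higher_derivative_circlepath)
       (use r in \<open>auto intro!: holomorphic_on_imp_continuous_on holomorphic_on_subset[OF g]\<close>)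
  also have "(deriv ^^ 1) ?g 0 = (2 * of_real pi * \<i>) ^ length xs * deriv (\<lambda>z. F (axis \<beta> z)) 0"
    using r F by (simp add: field_differentiable_axis[of F R])
  finally show ?thesis
    using lens_integral_eq_iterated_contour[OF r(1) cont _ set] xs distinct_card[of "\<beta> # xs"] set
    by simp
qed

end

section \<open>Linearity, norm bound and Pythagoras for means over the torus\<close>

lemma finite_measure_ext_prob_n:
  assumes "0 < r" shows "finite_measure (ext_prob_n r :: (complex ^ 'n) measure)"
proof -
  have inj: "inj (vec_lambda :: ('n \<Rightarrow> complex) \<Rightarrow> (complex, 'n) vec)"
    by (metis injI vec_lambda_inverse UNIV_I)
  show ?thesis
    unfolding ext_prob_n_def
    by (subst embed_measure_eq_distr[OF inj])
       \<comment> \<open>\<open>finite_measure_P\<close> comes from a context that fixes a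
         continuous function on the torus; the zero function fills that place.\<close>
       (intro finite_measure.finite_measure_distr[OF finite_measure_P[OF assms, of "\<lambda>_. 0"]]
         measurable_embed_measure2[OF inj], simp)
qed

context
  fixes r :: real
  assumes r: "0 < r"
begin

lemma lens_integrable:
  fixes F :: "complex ^ ('n :: {finite, linorder}) \<Rightarrow> complex"
  assumes "continuous_on (torus r) F"
  shows "integrable (ext_prob_n r) (\<lambda>w. F (to_torus r w))"
proof -
  obtain B where "\<And>w. w \<in> torus r \<Longrightarrow> norm (F w) \<le> B"
    using bound_G[OF r assms] by blast
  then show ?thesis
    using integral_ext_prob_n(1)[OF r assms] to_torus_mem[OF r]
    by (intro finite_measure.integrable_const_bound[OF finite_measure_ext_prob_n[OF r]]) auto
qed

lemma lens_integral_add: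
  fixes F G :: "complex ^ ('n :: {finite, linorder}) \<Rightarrow> complex"
  assumes "continuous_on (torus r) F" "continuous_on (torus r) G"
  shows "lens_integral r (\<lambda>w. F w + G w) = lens_integral r F + lens_integral r G"
  unfolding lens_integral_def
  by (rule Bochner_Integration.integral_add[OF lens_integrable[OF assms(1)] lens_integrable[OF assms(2)]])

lemma lens_integral_cmult:
  fixes F :: "complex ^ ('n :: {finite, linorder}) \<Rightarrow> complex"
  shows "lens_integral r (\<lambda>w. c * F w) = c * lens_integral r F"
  unfolding lens_integral_def by simp

lemma lens_integral_sum:
  fixes F :: "'i \<Rightarrow> complex ^ ('n :: {finite, linorder}) \<Rightarrow> complex"
  assumes "\<And>i. i \<in> I \<Longrightarrow> continuous_on (torus r) (F i)"
  shows "lens_integral r (\<lambda>w. \<Sum>i\<in>I. F i w) = (\<Sum>i\<in>I. lens_integral r (F i))"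
  unfolding lens_integral_def
  by (rule Bochner_Integration.integral_sum[OF lens_integrable[OF assms]])

lemma lens_integral_cnj:
  fixes F :: "complex ^ ('n :: {finite, linorder}) \<Rightarrow> complex"
  shows "lens_integral r (\<lambda>w. cnj (F w)) = cnj (lens_integral r F)"
  unfolding lens_integral_def by simp

lemma norm_lens_integral_le:
  fixes F :: "complex ^ ('n :: {finite, linorder}) \<Rightarrow> complex"
  assumes "continuous_on (torus r) F" "\<And>w. w \<in> torus r \<Longrightarrow> norm (F w) \<le> B"
  shows "norm (lens_integral r F) \<le> B"
proof -
  let ?M = "ext_prob_n r :: (complex, 'n) vec measure"
  interpret finite_measure ?M by (rule finite_measure_ext_prob_n[OF r])
  \<comment> \<open>The total mass is recovered from the mean value property of the constant 1; any
    radius beyond r would serve in place of \<open>r + 1\<close>.\<close>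
  have "lens_integral r (\<lambda>w :: (complex, 'n) vec. 1 :: complex) = 1"
    using r by (intro lens_integral_holomorphic[where R = "r + 1"] holomorphic_mv_const) auto
  then have "of_real (measure ?M (space ?M)) = (1 :: complex)"
    by (simp add: lens_integral_def scaleR_conv_of_real)
  then have 1: "measure ?M (space ?M) = 1" using of_real_eq_1_iff by blast
  have "norm (lens_integral r F) \<le> (\<integral>w. norm (F (to_torus r w)) \<partial>?M)"
    unfolding lens_integral_def by (rule integral_norm_bound)
  also have "\<dots> \<le> (\<integral>w. B \<partial>?M)"
    using assms(2) to_torus_mem[OF r]
    by (intro integral_mono integrable_norm lens_integrable assms(1)) auto
  finally show ?thesis by (simp add: 1)
qed

text \<open>One cross term suffices as a hypothesis, since the other is its complex
  conjugate.\<close>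

lemma lens_integral_pythagoras:
  fixes F G :: "complex ^ ('n :: {finite, linorder}) \<Rightarrow> complex"
  assumes F: "continuous_on (torus r) F" and G: "continuous_on (torus r) G"
    and orth: "lens_integral r (\<lambda>w. cnj (F w) * G w) = 0"
  shows "lens_integral r (\<lambda>w. cnj (F w + G w) * (F w + G w)) =
    lens_integral r (\<lambda>w. cnj (F w) * F w) + lens_integral r (\<lambda>w. cnj (G w) * G w)"
proof -
  have orth': "lens_integral r (\<lambda>w. cnj (G w) * F w) = 0"
    using lens_integral_cnj[of "\<lambda>w. cnj (F w) * G w"] orth by (simp add: mult.commute)
  have "lens_integral r (\<lambda>w. cnj (F w + G w) * (F w + G w)) =
      lens_integral r (\<lambda>w. (cnj (F w) * F w + cnj (F w) * G w) + (cnj (G w) * F w + cnj (G w) * G w))"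
    by (simp add: algebra_simps)
  also have "\<dots> = (lens_integral r (\<lambda>w. cnj (F w) * F w) + lens_integral r (\<lambda>w. cnj (F w) * G w)) +
      (lens_integral r (\<lambda>w. cnj (G w) * F w) + lens_integral r (\<lambda>w. cnj (G w) * G w))"
  proof -
    have c: "continuous_on (torus r) (\<lambda>w. cnj (H w) * K w)"
      if "continuous_on (torus r) H" "continuous_on (torus r) K" for H K :: "(complex, 'n) vec \<Rightarrow> complex"
      using that by (intro continuous_intros)
    show ?thesis
      by (simp only: lens_integral_add continuous_on_add c F G)
  qed
  finally show ?thesis by (simp add: orth orth')
qed

end

section \<open>Orthogonality of principal part, constant, linear part and remainder\<close>

lemma deriv_linear_form_axis:
  fixes e :: "'n :: finite \<Rightarrow> complex"
  shows "deriv (\<lambda>z. \<Sum>\<gamma>\<in>UNIV. e \<gamma> * axis \<beta> z $ \<gamma>) 0 = e \<beta>"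
proof -
  have "(\<Sum>\<gamma>\<in>UNIV. e \<gamma> * axis \<beta> z $ \<gamma>) = e \<beta> * z" for z
    by (simp add: axis_def if_distrib[of "\<lambda>x. _ * x"] cong: if_cong)
  then show ?thesis by simp
qed

text \<open>Serves two purposes: it makes the remainder orthogonal to the linear part, and it
  supplies the double zero behind the second-order bound.\<close>

lemma deriv_remainder_axis:
  fixes h :: "complex ^ 'n \<Rightarrow> complex"
  assumes h: "holomorphic_mv h (polydisc R)" and R: "0 < R"
    and D: "\<And>\<beta>. D \<beta> = deriv (\<lambda>z. h (axis \<beta> z)) 0"
  shows "deriv (\<lambda>z. h (axis \<beta> z) - h 0 - (\<Sum>\<gamma>\<in>UNIV. D \<gamma> * axis \<beta> z $ \<gamma>)) 0 = 0"
proof -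
  let ?d = "\<lambda>w :: (complex, 'n) vec. \<Sum>\<gamma>\<in>UNIV. D \<gamma> * w $ \<gamma>"
  have d: "holomorphic_mv ?d (polydisc R)" by (intro holomorphic_mv_intros)
  have fd: "(\<lambda>z. h (axis \<beta> z)) field_differentiable at 0"
    "(\<lambda>z. ?d (axis \<beta> z)) field_differentiable at 0"
    using R by (rule field_differentiable_axis[OF h], rule field_differentiable_axis[OF d])
  have "deriv (\<lambda>z. h (axis \<beta> z) - h 0 - ?d (axis \<beta> z)) 0 =
      deriv (\<lambda>z. h (axis \<beta> z) - h 0) 0 - deriv (\<lambda>z. ?d (axis \<beta> z)) 0"
    using fd by (intro deriv_diff field_differentiable_diff) auto
  also have "\<dots> = 0"
    using fd(1) by (simp add: deriv_diff deriv_linear_form_axis D)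
  finally show ?thesis .
qed

context
  fixes r R :: real
  assumes r: "0 < r" "r < R"
begin

text \<open>Taking F to be the linear form itself gives its squared norm; taking F to be the
  remainder gives 0.\<close>

lemma lens_integral_linear_form_holomorphic:
  fixes F :: "complex ^ ('n :: {finite, linorder}) \<Rightarrow> complex"
  assumes F: "holomorphic_mv F (polydisc R)"
  shows "lens_integral r (\<lambda>w. cnj (\<Sum>\<beta>\<in>UNIV. e \<beta> * w $ \<beta>) * F w) =
    (of_real r)\<^sup>2 * (\<Sum>\<beta>\<in>UNIV. cnj (e \<beta>) * deriv (\<lambda>z. F (axis \<beta> z)) 0)"
proof -
  have "lens_integral r (\<lambda>w. cnj (\<Sum>\<beta>\<in>UNIV. e \<beta> * w $ \<beta>) * F w) =
      lens_integral r (\<lambda>w. \<Sum>\<beta>\<in>UNIV. ((of_real r)\<^sup>2 * cnj (e \<beta>)) * (F w / w $ \<beta>))"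
    using r(1) by (intro lens_integral_cong) (auto simp: sum_distrib_right cnj_torus intro!: sum.cong)
  also have "\<dots> = (\<Sum>\<beta>\<in>UNIV. ((of_real r)\<^sup>2 * cnj (e \<beta>)) * deriv (\<lambda>z. F (axis \<beta> z)) 0)"
  proof -
    have "continuous_on (torus r) (\<lambda>w. k * (F w / w $ \<beta>))" for k \<beta>
      using torus_nonzero[OF r(1)]
      by (intro continuous_intros holomorphic_mv_continuous_on_torus[OF r F]) auto
    then show ?thesis
      by (simp only: lens_integral_sum[OF r(1)] lens_integral_cmult[OF r(1)]
          lens_integral_holomorphic_divide_coord[OF r F])
  qed
  finally show ?thesis by (simp add: sum_distrib_left mult.assoc)
qed

text \<open>On the torus \<open>1 / w\<^sub>\<beta>\<close> is a multiple of the conjugate of \<open>w\<^sub>\<beta>\<close>, which reduces the principal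
  part to a linear form.\<close>

lemma cnj_principal_part_torus:
  assumes "w \<in> torus r"
  shows "cnj (\<Sum>\<beta>\<in>UNIV. c \<beta> / w $ \<beta>) = inverse ((of_real r)\<^sup>2) * (\<Sum>\<beta>\<in>UNIV. cnj (c \<beta>) * w $ \<beta>)"
  using r(1) assms torus_nonzero[OF r(1) assms]
  by (auto simp: sum_distrib_left cnj_torus field_simps intro!: sum.cong)

text \<open>On the torus the integrand agrees with a holomorphic function containing a linear form
  as a factor. It vanishes at 0, and so does its mean.\<close>

lemma lens_integral_principal_part_holomorphic:
  fixes F :: "complex ^ ('n :: {finite, linorder}) \<Rightarrow> complex"
  assumes F: "holomorphic_mv F (polydisc R)"
  shows "lens_integral r (\<lambda>w. cnj (\<Sum>\<beta>\<in>UNIV. c \<beta> / w $ \<beta>) * F w) = 0"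
proof -
  have "lens_integral r (\<lambda>w. cnj (\<Sum>\<beta>\<in>UNIV. c \<beta> / w $ \<beta>) * F w) =
      lens_integral r (\<lambda>w. inverse ((of_real r)\<^sup>2) * (\<Sum>\<beta>\<in>UNIV. cnj (c \<beta>) * w $ \<beta>) * F w)"
    using r(1) by (intro lens_integral_cong) (simp_all only: cnj_principal_part_torus)
  also have "\<dots> = 0"
    by (subst lens_integral_holomorphic[OF r]) (intro holomorphic_mv_intros F, simp)
  finally show ?thesis .
qed

text \<open>The principal part is \<open>inverse ((of_real r)\<^sup>2)\<close> times a conjugated
  linear form. Two such factors give r to the power -4, the squared norm of the linear form gives
  back r squared, and the power -2 remains.\<close>

lemma lens_integral_principal_part_sq:
  fixes c :: "'n :: {finite, linorder} \<Rightarrow> complex"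
  shows "lens_integral r (\<lambda>w. cnj (\<Sum>\<beta>\<in>UNIV. c \<beta> / w $ \<beta>) * (\<Sum>\<beta>\<in>UNIV. c \<beta> / w $ \<beta>)) =
    (\<Sum>\<beta>\<in>UNIV. cnj (c \<beta>) * c \<beta>) / (of_real r)\<^sup>2"
proof -
  let ?d = "\<lambda>w :: (complex, 'n) vec. \<Sum>\<beta>\<in>UNIV. cnj (c \<beta>) * w $ \<beta>"
  have p: "(\<Sum>\<beta>\<in>UNIV. c \<beta> / w $ \<beta>) = inverse ((of_real r)\<^sup>2) * cnj (?d w)" if "w \<in> torus r" for w
    using arg_cong[OF cnj_principal_part_torus[OF that, of c], of cnj]
    by (simp only: complex_cnj_cnj complex_cnj_mult complex_cnj_inverse complex_cnj_power complex_cnj_complex_of_real)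
  have "lens_integral r (\<lambda>w. cnj (\<Sum>\<beta>\<in>UNIV. c \<beta> / w $ \<beta>) * (\<Sum>\<beta>\<in>UNIV. c \<beta> / w $ \<beta>)) =
      lens_integral r (\<lambda>w. inverse ((of_real r) ^ 4) * (cnj (?d w) * ?d w))"
  proof (rule lens_integral_cong[OF r(1)])
    fix w :: "(complex, 'n) vec" assume w: "w \<in> torus r"
    show "cnj (\<Sum>\<beta>\<in>UNIV. c \<beta> / w $ \<beta>) * (\<Sum>\<beta>\<in>UNIV. c \<beta> / w $ \<beta>) =
        inverse ((of_real r) ^ 4) * (cnj (?d w) * ?d w)"
      unfolding p[OF w] complex_cnj_mult complex_cnj_cnj complex_cnj_inverse complex_cnj_power
        complex_cnj_complex_of_real
      using r(1) by (simp add: field_simps power2_eq_square power4_eq_xxxx)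
  qed
  also have "\<dots> = inverse ((of_real r) ^ 4) * ((of_real r)\<^sup>2 * (\<Sum>\<beta>\<in>UNIV. c \<beta> * cnj (c \<beta>)))"
    by (subst lens_integral_cmult[OF r(1)], subst lens_integral_linear_form_holomorphic)
       (intro holomorphic_mv_intros, simp add: deriv_linear_form_axis)
  also have "\<dots> = (\<Sum>\<beta>\<in>UNIV. cnj (c \<beta>) * c \<beta>) / (of_real r)\<^sup>2"
    using r(1) by (simp add: field_simps power2_eq_square power4_eq_xxxx)
  finally show ?thesis .
qed

text \<open>This is the computation of a residue. The quotient
  \<open>w $ \<beta> / w $ \<gamma>\<close> has as mean the derivative of the coordinate \<beta>
  along the axis \<gamma>, which is 1 for \<gamma> = \<beta> and 0 otherwise, while
  \<open>F w * w $ \<beta>\<close> is holomorphic and vanishes at 0.\<close>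

lemma lens_integral_coord_mult:
  fixes F :: "complex ^ ('n :: {finite, linorder}) \<Rightarrow> complex" and c :: "'n \<Rightarrow> complex"
  assumes F: "holomorphic_mv F (polydisc R)"
  shows "lens_integral r (\<lambda>w. ((\<Sum>\<gamma>\<in>UNIV. c \<gamma> / w $ \<gamma>) + F w) * w $ \<beta>) = c \<beta>"
proof -
  have c1: "continuous_on (torus r) (\<lambda>w :: (complex, 'n) vec. c \<gamma> * (w $ \<beta> / w $ \<gamma>))" for \<gamma>
    using torus_nonzero[OF r(1)] by (intro continuous_intros) auto
  have hol: "holomorphic_mv (\<lambda>w. F w * w $ \<beta>) (polydisc R)"
    by (intro holomorphic_mv_intros F)
  have "lens_integral r (\<lambda>w :: (complex, 'n) vec. w $ \<beta> / w $ \<gamma>) = (if \<gamma> = \<beta> then 1 else 0)" for \<gamma>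
    by (subst lens_integral_holomorphic_divide_coord[OF r holomorphic_mv_coord])
       (auto simp: axis_def)
  then have 1: "lens_integral r (\<lambda>w :: (complex, 'n) vec. \<Sum>\<gamma>\<in>UNIV. c \<gamma> * (w $ \<beta> / w $ \<gamma>)) = c \<beta>"
    by (simp only: lens_integral_sum[OF r(1)] c1 lens_integral_cmult[OF r(1)]) (simp add: if_distrib cong: if_cong)
  have "lens_integral r (\<lambda>w. ((\<Sum>\<gamma>\<in>UNIV. c \<gamma> / w $ \<gamma>) + F w) * w $ \<beta>) =
      lens_integral r (\<lambda>w. (\<Sum>\<gamma>\<in>UNIV. c \<gamma> * (w $ \<beta> / w $ \<gamma>)) + F w * w $ \<beta>)"
    by (simp add: algebra_simps sum_distrib_left)
  also have "\<dots> = c \<beta> + lens_integral r (\<lambda>w. F w * w $ \<beta>)"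
    by (simp only: lens_integral_add[OF r(1) continuous_on_sum[OF c1] holomorphic_mv_continuous_on_torus[OF r hol]] 1)
  also have "lens_integral r (\<lambda>w. F w * w $ \<beta>) = 0"
    by (subst lens_integral_holomorphic[OF r hol]) simp
  finally show ?thesis by simp
qed

text \<open>Each of three applications of Pythagoras splits one summand off the whole remaining sum.
  Thus three orthogonality relations suffice instead of the six between pairs of summands.\<close>

lemma lens_integral_sq_decomposition:
  fixes h :: "complex ^ ('n :: {finite, linorder}) \<Rightarrow> complex" and c D :: "'n \<Rightarrow> complex"
  assumes h: "holomorphic_mv h (polydisc R)"
    and D: "\<And>\<beta>. D \<beta> = deriv (\<lambda>z. h (axis \<beta> z)) 0"
  defines "u \<equiv> \<lambda>w. \<Sum>\<beta>\<in>UNIV. c \<beta> / w $ \<beta>"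
    and "p \<equiv> \<lambda>w. h w - h 0 - (\<Sum>\<beta>\<in>UNIV. D \<beta> * w $ \<beta>)"
  shows "lens_integral r (\<lambda>w. cnj (u w + h w) * (u w + h w)) =
    (\<Sum>\<beta>\<in>UNIV. cnj (c \<beta>) * c \<beta>) / (of_real r)\<^sup>2 + cnj (h 0) * h 0
    + (of_real r)\<^sup>2 * (\<Sum>\<beta>\<in>UNIV. cnj (D \<beta>) * D \<beta>)
    + lens_integral r (\<lambda>w. cnj (p w) * p w)"
proof -
  let ?d = "\<lambda>w :: (complex, 'n) vec. \<Sum>\<beta>\<in>UNIV. D \<beta> * w $ \<beta>"
  note cont = holomorphic_mv_continuous_on_torus[OF r]
  have hol: "holomorphic_mv ?d (polydisc R)" "holomorphic_mv p (polydisc R)"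
    "holomorphic_mv (\<lambda>w. ?d w + p w) (polydisc R)" "holomorphic_mv (\<lambda>w. h 0) (polydisc R)"
    unfolding p_def by (intro holomorphic_mv_intros h)+
  have u: "continuous_on (torus r) u"
    unfolding u_def using torus_nonzero[OF r(1)] by (intro continuous_intros) auto
  have p0: "?d 0 + p 0 = 0" by (simp add: p_def)
  have dp: "deriv (\<lambda>z. p (axis \<beta> z)) 0 = 0" for \<beta>
    unfolding p_def using r D by (intro deriv_remainder_axis[OF h]) auto
  have "lens_integral r (\<lambda>w. cnj (u w + h w) * (u w + h w)) =
      lens_integral r (\<lambda>w. cnj (u w) * u w) + lens_integral r (\<lambda>w. cnj (h w) * h w)"
    using lens_integral_principal_part_holomorphic[OF h, of c]
    by (intro lens_integral_pythagoras r u cont h) (simp add: u_def)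
  also have "(\<lambda>w. cnj (h w) * h w) = (\<lambda>w. cnj (h 0 + (?d w + p w)) * (h 0 + (?d w + p w)))"
    by (simp add: p_def)
  also have "lens_integral r \<dots> = lens_integral r (\<lambda>w :: (complex, 'n) vec. cnj (h 0) * h 0) +
      lens_integral r (\<lambda>w. cnj (?d w + p w) * (?d w + p w))"
  proof (intro lens_integral_pythagoras r cont hol)
    have "lens_integral r (\<lambda>w. cnj (h 0) * (?d w + p w)) = cnj (h 0) * (?d 0 + p 0)"
      unfolding lens_integral_cmult[OF r(1)] by (subst lens_integral_holomorphic[OF r hol(3)]) (rule refl)
    then show "lens_integral r (\<lambda>w. cnj (h 0) * (?d w + p w)) = 0" unfolding p0 by simp
  qed
  also have "lens_integral r (\<lambda>w :: (complex, 'n) vec. cnj (h 0) * h 0) = cnj (h 0) * h 0"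
    by (rule lens_integral_holomorphic[OF r]) (rule holomorphic_mv_const)
  also have "lens_integral r (\<lambda>w. cnj (?d w + p w) * (?d w + p w)) =
      lens_integral r (\<lambda>w. cnj (?d w) * ?d w) + lens_integral r (\<lambda>w. cnj (p w) * p w)"
    by (intro lens_integral_pythagoras r cont hol)
       (subst lens_integral_linear_form_holomorphic[OF hol(2)], simp add: dp)
  also have "lens_integral r (\<lambda>w. cnj (?d w) * ?d w) = (of_real r)\<^sup>2 * (\<Sum>\<beta>\<in>UNIV. cnj (D \<beta>) * D \<beta>)"
    unfolding lens_integral_linear_form_holomorphic[OF hol(1)] deriv_linear_form_axis ..
  finally show ?thesis
    using lens_integral_principal_part_sq[of c] by (simp add: u_def)
qed

end

section \<open>The remainder is of second order\<close>

text \<open>Each use of \<open>Schwarz3\<close> divides out one factor z, leaving f z = z^2 * k z.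
  On the unit circle k has the same modulus as f, so the maximum principle carries the bound B to
  the whole disc; \<rho> > 1 makes k continuous up to the circle.\<close>

lemma norm_le_square_of_double_zero:
  assumes f: "f holomorphic_on ball 0 \<rho>" and \<rho>: "1 < \<rho>" and f0: "f 0 = 0" "deriv f 0 = 0"
    and B: "\<And>z. norm z = 1 \<Longrightarrow> norm (f z) \<le> B" and z: "norm z \<le> 1"
  shows "norm (f z) \<le> B * (norm z)\<^sup>2"
proof -
  obtain g where g: "g holomorphic_on ball 0 \<rho>" "\<And>z. norm z < \<rho> \<Longrightarrow> f z = z * g z" "deriv f 0 = g 0"
    using Schwarz3[OF f f0(1)] by blast
  have "g 0 = 0" using g(3) f0(2) by simp
  then obtain k where k: "k holomorphic_on ball 0 \<rho>" "\<And>z. norm z < \<rho> \<Longrightarrow> g z = z * k z"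
    using Schwarz3[OF g(1)] by blast
  have fk: "norm (f z) = (norm z)\<^sup>2 * norm (k z)" if "norm z \<le> 1" for z
    using that \<rho> g(2) k(2) by (simp add: norm_mult power2_eq_square)
  have "norm (k z) \<le> B"
  proof (rule maximum_modulus_frontier[of k "cball 0 1"])
    show "k holomorphic_on interior (cball 0 1)" "continuous_on (closure (cball 0 1)) k"
      using \<rho> by (auto intro!: holomorphic_on_imp_continuous_on holomorphic_on_subset[OF k(1)])
    show "norm (k w) \<le> B" if "w \<in> frontier (cball 0 1)" for w
      using that fk[of w] B[of w] by (auto simp: frontier_cball)
  qed (use z in auto)
  then show ?thesis
    using fk[OF z] by (simp add: mult.commute[of B] mult_left_mono)
qed

lemma holomorphic_mv_second_order:
  fixes p :: "complex ^ 'n \<Rightarrow> complex"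
  assumes p: "holomorphic_mv p (polydisc R)" and s: "0 < s" "s < R"
    and p0: "p 0 = 0" "\<And>\<beta>. deriv (\<lambda>z. p (axis \<beta> z)) 0 = 0"
  obtains C where "0 \<le> C" "\<And>r w. 0 < r \<Longrightarrow> r \<le> s \<Longrightarrow> w \<in> torus r \<Longrightarrow> norm (p w) \<le> C * r\<^sup>2"
proof -
  have "continuous_on (torus s) p"
    using holomorphic_mv_continuous_on[OF p] torus_subset_polydisc[OF s(2)] by (rule continuous_on_subset)
  then obtain B where B: "0 \<le> B" "\<And>w. w \<in> torus s \<Longrightarrow> norm (p w) \<le> B"
    using bound_G[OF s(1)] by blast
  show ?thesis
  proof (rule that[of "B / s\<^sup>2"])
    fix r and w :: "(complex, 'n) vec"
    assume r: "0 < r" "r \<le> s" and w: "w \<in> torus r"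
    \<comment> \<open>Radial rescaling puts u on the fixed torus of radius s. The line through u
      meets that torus for |z| = 1 and passes through w at z = r/s, so the single bound B yields the
      constant \<open>B / s\<^sup>2\<close> for all r.\<close>
    define u where "u = of_real (s / r) *s w"
    let ?z = "of_real (r / s) :: complex"
    have uw: "?z *s u = w" using r s by (simp add: u_def vec_eq_iff)
    have u: "z *s u \<in> torus s" if "norm z = 1" for z
      using that w r s by (simp add: u_def torus_def norm_mult norm_divide)
    have "(\<lambda>z. p (0 + z *s u)) holomorphic_on ball 0 (R / s)"
      using w r s
      by (intro holomorphic_mv_line[OF p])
         (auto simp: u_def torus_def polydisc_def norm_mult norm_divide field_simps)
    moreover have "deriv (\<lambda>z. p (z *s u)) 0 = 0"
      using DERIV_imp_deriv[OF has_field_derivative_line_0[OF p, of u]] s p0(2) by simp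
    ultimately have "norm (p (?z *s u)) \<le> B * (norm ?z)\<^sup>2"
      using s r p0(1) B(2) u by (intro norm_le_square_of_double_zero) (auto simp: norm_divide)
    then show "norm (p w) \<le> B / s\<^sup>2 * r\<^sup>2"
      unfolding uw using r s by (simp add: norm_divide power_divide)
  qed (use B in auto)
qed

section \<open>The decomposition\<close>

text \<open>Guarantees that the \<open>Lim\<close> in \<open>analytic_component\<close> is
  determined by convergence. Adding the same small real t to every coordinate of w avoids the
  hyperplanes, because each coordinate rules out at most one t.\<close>

lemma at_within_off_axes_nontrivial: "at (w :: complex ^ 'n) within off_axes \<noteq> bot"
  unfolding trivial_limit_within islimpt_approachable not_not
proof (intro allI impI)
  fix e :: real assume e: "0 < e"
  let ?v = "\<lambda>t. \<chi> \<beta>. w $ \<beta> + of_real t"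
  let ?T = "\<Union>\<beta>. {t. w $ \<beta> + complex_of_real t = 0}"
  have "finite {t. w $ \<beta> + complex_of_real t = 0}" for \<beta>
    by (rule finite_subset[of _ "{- Re (w $ \<beta>)}"]) (auto simp: complex_eq_iff)
  then have "finite ?T" by simp
  \<comment> \<open>The distance moved is at most the sum of \<open>CARD('n)\<close> terms equal to
    t, hence this bound on t.\<close>
  moreover have "infinite {0<..<e / CARD('n)}"
    using e by (intro infinite_Ioo) simp
  ultimately obtain t where t: "0 < t" "t < e / CARD('n)" "t \<notin> ?T"
    by (metis (no_types, lifting) greaterThanLessThan_iff rev_finite_subset subsetI)
  have "?v t \<in> off_axes" using t(3) by (auto simp: off_axes_def)
  moreover have "?v t \<noteq> w" using t(1) by (auto simp: vec_eq_iff)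
  moreover have "dist (?v t) w < e"
  proof -
    have "dist (?v t) w \<le> (\<Sum>\<beta>\<in>UNIV. norm ((?v t - w) $ \<beta>))"
      unfolding dist_norm norm_vec_def by (rule L2_set_le_sum) simp
    also have "\<dots> < e" using t by (simp add: field_simps)
    finally show ?thesis .
  qed
  ultimately show "\<exists>v\<in>off_axes. v \<noteq> w \<and> dist v w < e" by blast
qed

lemma matrix_trace_conj_transpose:
  fixes A :: "complex ^ 'n ^ 'k"
  shows "trace (conj_transpose A ** A) = (\<Sum>\<alpha>\<in>UNIV. \<Sum>\<beta>\<in>UNIV. cnj (A $ \<alpha> $ \<beta>) * A $ \<alpha> $ \<beta>)"
  unfolding trace_def matrix_matrix_mult_def conj_transpose_def
  by (simp, rule sum.swap)

lemma lens_inner_self_eq_sum: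
  fixes F :: "complex ^ ('n :: {finite, linorder}) \<Rightarrow> complex ^ 'k"
  assumes "0 < r" "\<And>\<alpha>. continuous_on (torus r) (\<lambda>w. F w $ \<alpha>)"
  shows "lens_inner r F F = (\<Sum>\<alpha>\<in>UNIV. lens_integral r (\<lambda>w. cnj (F w $ \<alpha>) * F w $ \<alpha>))"
  unfolding lens_inner_def
  by (rule lens_integral_sum[OF assms(1)]) (intro continuous_intros assms(2))

lemma lens_integral_component:
  fixes F :: "complex ^ ('n :: {finite, linorder}) \<Rightarrow> complex ^ 'k"
  assumes "0 < r" "\<And>\<alpha>. continuous_on (torus r) (\<lambda>w. F w $ \<alpha>)"
  shows "lens_integral r F $ \<alpha> = lens_integral r (\<lambda>w. F w $ \<alpha>)"
proof -
  let ?M = "ext_prob_n r :: (complex, 'n) vec measure"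
  have lin: "bounded_linear (axis \<gamma> :: complex \<Rightarrow> complex ^ 'k)" for \<gamma> :: 'k
    unfolding linear_conv_bounded_linear[symmetric]
    by (rule linearI) (auto simp: axis_def vec_eq_iff)
  have eq: "v = (\<Sum>\<gamma>\<in>UNIV. axis \<gamma> (v $ \<gamma>))" for v :: "complex ^ 'k"
    by (auto simp: vec_eq_iff axis_def)
  \<comment> \<open>A projection commutes with the integral once F itself is integrable, so
    integrability is assembled from the components.\<close>
  have "integrable ?M (\<lambda>w. axis \<gamma> (F (to_torus r w) $ \<gamma>))" for \<gamma>
    by (rule integrable_bounded_linear[OF lin lens_integrable[OF assms]])
  then have "integrable ?M (\<lambda>w. \<Sum>\<gamma>\<in>UNIV. axis \<gamma> (F (to_torus r w) $ \<gamma>))"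
    by (rule Bochner_Integration.integrable_sum)
  then have "integrable ?M (\<lambda>w. F (to_torus r w))"
    unfolding eq[symmetric] .
  then show ?thesis
    unfolding lens_integral_def by (rule integral_bounded_linear[OF bounded_linear_vec_nth, symmetric])
qed

lemma of_real_norm_square_vec:
  fixes v :: "complex ^ 'k"
  shows "complex_of_real ((norm v)\<^sup>2) = (\<Sum>\<alpha>\<in>UNIV. cnj (v $ \<alpha>) * v $ \<alpha>)"
proof -
  have "(norm v)\<^sup>2 = (\<Sum>\<alpha>\<in>UNIV. (cmod (v $ \<alpha>))\<^sup>2)"
    by (simp add: norm_vec_def L2_set_def sum_nonneg)
  then show ?thesis
    by (simp add: complex_norm_square mult.commute del: of_real_power)
qed

section \<open>Contour data in terms of the pole coefficients c and the holomorphic part h\<close>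

context
  fixes f h :: "complex ^ ('n :: {finite, linorder}) \<Rightarrow> complex ^ 'k"
    and c :: "'n \<Rightarrow> complex ^ 'k" and R :: real
  assumes h: "\<And>\<alpha>. holomorphic_mv (\<lambda>w. h w $ \<alpha>) (polydisc R)"
    and f: "\<And>w. w \<in> polydisc R \<inter> off_axes \<Longrightarrow> f w = (\<Sum>\<beta>\<in>UNIV. (1 / w $ \<beta>) *s c \<beta>) + h w"
begin

lemma component_off_axes:
  "w \<in> polydisc R \<inter> off_axes \<Longrightarrow> f w $ \<alpha> = (\<Sum>\<beta>\<in>UNIV. c \<beta> $ \<alpha> / w $ \<beta>) + h w $ \<alpha>"
  by (simp add: f)

lemma component_torus:
  assumes "0 < r" "r < R" "w \<in> torus r"
  shows "f w $ \<alpha> = (\<Sum>\<beta>\<in>UNIV. c \<beta> $ \<alpha> / w $ \<beta>) + h w $ \<alpha>"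
  using assms by (intro component_off_axes) (auto simp: torus_def polydisc_def off_axes_def)

lemma continuous_on_torus_component:
  assumes r: "0 < r" "r < R"
  shows "continuous_on (torus r) (\<lambda>w. f w $ \<alpha>)"
proof -
  have "continuous_on (torus r) (\<lambda>w. (\<Sum>\<beta>\<in>UNIV. c \<beta> $ \<alpha> / w $ \<beta>) + h w $ \<alpha>)"
    using torus_nonzero[OF r(1)]
    by (intro continuous_intros holomorphic_mv_continuous_on_torus[OF r h]) auto
  then show ?thesis
    by (simp add: component_torus[OF r] cong: continuous_on_cong)
qed

lemma lens_integral_core:
  assumes r: "0 < r" "r < R"
  shows "lens_integral r (\<lambda>w. f w $ \<alpha>) = h 0 $ \<alpha>"
proof -
  have c0: "continuous_on (torus r) (\<lambda>w :: (complex, 'n) vec. c \<beta> $ \<alpha> / w $ \<beta>)" for \<beta>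
    using torus_nonzero[OF r(1)] by (intro continuous_intros) auto
  have c1: "continuous_on (torus r) (\<lambda>w :: (complex, 'n) vec. \<Sum>\<beta>\<in>UNIV. c \<beta> $ \<alpha> / w $ \<beta>)"
    by (intro continuous_on_sum c0)
  have z: "lens_integral r (\<lambda>w :: (complex, 'n) vec. c \<beta> $ \<alpha> / w $ \<beta>) = 0" for \<beta>
    by (subst lens_integral_holomorphic_divide_coord[OF r holomorphic_mv_const]) simp
  have "lens_integral r (\<lambda>w. f w $ \<alpha>) =
      lens_integral r (\<lambda>w. (\<Sum>\<beta>\<in>UNIV. c \<beta> $ \<alpha> / w $ \<beta>) + h w $ \<alpha>)"
    by (rule lens_integral_cong[OF r(1) component_torus[OF r]])
  also have "\<dots> = h 0 $ \<alpha>"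
    by (simp only: lens_integral_add[OF r(1) c1 holomorphic_mv_continuous_on_torus[OF r h]]
        lens_integral_sum[OF r(1)] c0 z lens_integral_holomorphic[OF r h]) simp
  finally show ?thesis .
qed

text \<open>Here and in the identifications of residues and Jacobian the result no longer involves
  s, so coefficients taken at one radius are valid at every radius below R.\<close>

lemma core_component_eq:
  assumes s: "0 < s" "s < R"
  shows "core_component s f = h 0"
  unfolding core_component_def vec_eq_iff
  using integral_ext_prob_n(2)[OF s(1) continuous_on_torus_component[OF s]] lens_integral_core[OF s]
  by simp

lemma residue_matrix_eq:
  assumes s: "0 < s" "s < R"
  shows "residue_matrix s f $ \<alpha> $ \<beta> = c \<beta> $ \<alpha>"
proof -
  have cont: "continuous_on (torus s) (\<lambda>w. f w $ \<alpha> * w $ \<beta>)"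
    by (intro continuous_intros continuous_on_torus_component s)
  \<comment> \<open>Multiplying numerator and denominator by \<open>w $ \<beta>\<close> completes
    the product to the weight of the mean, so the residue becomes the mean of f times a
    coordinate.\<close>
  have "torus_contour s (\<lambda>w. f w $ \<alpha> / (\<Prod>\<mu>\<in>UNIV - {\<beta>}. w $ \<mu>)) =
      torus_contour s (\<lambda>w. f w $ \<alpha> * w $ \<beta> / (\<Prod>\<mu>\<in>UNIV. w $ \<mu>))"
  proof (rule torus_contour_cong[OF s(1)])
    fix w :: "(complex, 'n) vec" assume "w \<in> torus s"
    then have "w $ \<beta> \<noteq> 0" by (rule torus_nonzero[OF s(1)])
    moreover have "(\<Prod>\<mu>\<in>UNIV. w $ \<mu>) = w $ \<beta> * (\<Prod>\<mu>\<in>UNIV - {\<beta>}. w $ \<mu>)"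
      by (rule prod.remove) auto
    ultimately show "f w $ \<alpha> / (\<Prod>\<mu>\<in>UNIV - {\<beta>}. w $ \<mu>) =
        f w $ \<alpha> * w $ \<beta> / (\<Prod>\<mu>\<in>UNIV. w $ \<mu>)"
      by simp
  qed
  then have "residue_matrix s f $ \<alpha> $ \<beta> = lens_integral s (\<lambda>w. f w $ \<alpha> * w $ \<beta>)"
    by (simp add: residue_matrix_def integral_ext_prob_n(2)[OF s(1) cont])
  also have "\<dots> = lens_integral s (\<lambda>w. ((\<Sum>\<beta>\<in>UNIV. c \<beta> $ \<alpha> / w $ \<beta>) + h w $ \<alpha>) * w $ \<beta>)"
    by (rule lens_integral_cong[OF s(1)]) (simp only: component_torus[OF s])
  also have "\<dots> = c \<beta> $ \<alpha>"
    by (rule lens_integral_coord_mult[OF s h])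
  finally show ?thesis .
qed

text \<open>Off the coordinate hyperplanes the principal parts cancel exactly; continuity of h then
  gives the limit also at points on the hyperplanes.\<close>

lemma analytic_component_eq:
  assumes s: "0 < s" "s < R" and w: "w \<in> polydisc R"
  shows "analytic_component s f w = h w - h 0"
  unfolding analytic_component_def
proof (rule tendsto_Lim[OF at_within_off_axes_nontrivial])
  have "((\<lambda>v. h v $ \<alpha>) \<longlongrightarrow> h w $ \<alpha>) (at w within off_axes)" for \<alpha>
    using holomorphic_mv_continuous_on[OF h] w continuous_on_eq_continuous_at[OF open_polydisc]
    by (metis Lim_at_imp_Lim_at_within isCont_def)
  then have "(h \<longlongrightarrow> h w) (at w within off_axes)"
    by (rule vec_tendstoI)
  then have "((\<lambda>v. h v - h 0) \<longlongrightarrow> h w - h 0) (at w within off_axes)"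
    by (intro tendsto_intros)
  moreover have "\<forall>\<^sub>F v in at w within off_axes.
      h v - h 0 = f v - core_component s f - principal_component s f v"
    unfolding eventually_at_topological
  proof (intro exI[of _ "polydisc R"] conjI ballI impI)
    fix v :: "(complex, 'n) vec"
    assume "v \<in> polydisc R" "v \<in> off_axes"
    then show "h v - h 0 = f v - core_component s f - principal_component s f v"
      by (simp add: vec_eq_iff component_off_axes core_component_eq[OF s] principal_component_def
          residue_matrix_eq[OF s])
  qed (use w open_polydisc in auto)
  ultimately show "((\<lambda>v. f v - core_component s f - principal_component s f v) \<longlongrightarrow> h w - h 0)
      (at w within off_axes)"
    by (rule Lim_transform_eventually)
qed

text \<open>For n \<ge> 2 the points \<open>axis \<beta> z\<close> are outside
  \<open>off_axes\<close>, so the derivative sees the limit values supplied by h and not the values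
  of f. Agreement for z near 0 is enough for \<open>deriv\<close>.\<close>

lemma jacobian_at_0_eq:
  assumes s: "0 < s" "s < R"
  shows "jacobian_at_0 s f $ \<alpha> $ \<beta> = deriv (\<lambda>z. h (axis \<beta> z) $ \<alpha>) 0"
proof -
  have R: "0 < R" using s by simp
  have "\<forall>\<^sub>F z in nhds 0. analytic_component s f (axis \<beta> z) $ \<alpha> = h (axis \<beta> z) $ \<alpha> - h 0 $ \<alpha>"
    using eventually_nhds_in_open[of "ball 0 R" "0 :: complex"] R
    by (auto elim!: eventually_mono simp: analytic_component_eq[OF s] polydisc_def axis_def)
  then have "jacobian_at_0 s f $ \<alpha> $ \<beta> = deriv (\<lambda>z. h (axis \<beta> z) $ \<alpha> - h 0 $ \<alpha>) 0"
    unfolding jacobian_at_0_def by (simp cong: deriv_cong_ev)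
  also have "\<dots> = deriv (\<lambda>z. h (axis \<beta> z) $ \<alpha>) 0"
    using field_differentiable_axis[OF h R] by (simp add: deriv_diff)
  finally show ?thesis .
qed

lemma higher_order_eq:
  assumes s: "0 < s" "s < R" and w: "w \<in> polydisc R"
  shows "higher_order s f w $ \<alpha> =
    h w $ \<alpha> - h 0 $ \<alpha> - (\<Sum>\<beta>\<in>UNIV. jacobian_at_0 s f $ \<alpha> $ \<beta> * w $ \<beta>)"
  by (simp add: higher_order_def analytic_component_eq[OF s w] matrix_vector_mult_def)

lemma lens_variance_eq:
  assumes s: "0 < s" "s < R" and r: "0 < r" "r < R"
  defines "\<eta> \<equiv> residue_matrix s f" and "\<D> \<equiv> jacobian_at_0 s f"
  shows "lens_variance r f =
    trace (conj_transpose \<eta> ** \<eta>) / (complex_of_real r)\<^sup>2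
    + (complex_of_real r)\<^sup>2 * trace (conj_transpose \<D> ** \<D>)
    + lens_inner r (higher_order s f) (higher_order s f)"
proof -
  let ?p = "\<lambda>\<alpha> w. h w $ \<alpha> - h 0 $ \<alpha> - (\<Sum>\<beta>\<in>UNIV. \<D> $ \<alpha> $ \<beta> * w $ \<beta>)"
  have ho: "higher_order s f w $ \<alpha> = ?p \<alpha> w" if "w \<in> torus r" for w \<alpha>
    using that torus_subset_polydisc[OF r(2)] unfolding \<D>_def by (intro higher_order_eq[OF s]) auto
  have "holomorphic_mv (?p \<alpha>) (polydisc R)" for \<alpha>
    by (intro holomorphic_mv_intros h)
  then have "continuous_on (torus r) (?p \<alpha>)" for \<alpha>
    by (intro holomorphic_mv_continuous_on_torus[OF r])
  then have "continuous_on (torus r) (\<lambda>w. higher_order s f w $ \<alpha>)" for \<alpha>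
    by (simp add: ho cong: continuous_on_cong)
  then have "lens_inner r (higher_order s f) (higher_order s f) =
      (\<Sum>\<alpha>\<in>UNIV. lens_integral r (\<lambda>w. cnj (higher_order s f w $ \<alpha>) * higher_order s f w $ \<alpha>))"
    by (rule lens_inner_self_eq_sum[OF r(1)])
  also have "\<dots> = (\<Sum>\<alpha>\<in>UNIV. lens_integral r (\<lambda>w. cnj (?p \<alpha> w) * ?p \<alpha> w))"
    by (intro sum.cong refl lens_integral_cong[OF r(1)]) (simp only: ho)
  finally have inner: "lens_inner r (higher_order s f) (higher_order s f) = \<dots>" .
  have "lens_integral r (\<lambda>w. cnj (f w $ \<alpha>) * f w $ \<alpha>) =
      (\<Sum>\<beta>\<in>UNIV. cnj (\<eta> $ \<alpha> $ \<beta>) * \<eta> $ \<alpha> $ \<beta>) / (of_real r)\<^sup>2 + cnj (h 0 $ \<alpha>) * h 0 $ \<alpha>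
      + (of_real r)\<^sup>2 * (\<Sum>\<beta>\<in>UNIV. cnj (\<D> $ \<alpha> $ \<beta>) * \<D> $ \<alpha> $ \<beta>)
      + lens_integral r (\<lambda>w. cnj (?p \<alpha> w) * ?p \<alpha> w)" for \<alpha>
  proof -
    have "lens_integral r (\<lambda>w. cnj (f w $ \<alpha>) * f w $ \<alpha>) =
        lens_integral r (\<lambda>w. cnj ((\<Sum>\<beta>\<in>UNIV. \<eta> $ \<alpha> $ \<beta> / w $ \<beta>) + h w $ \<alpha>) *
          ((\<Sum>\<beta>\<in>UNIV. \<eta> $ \<alpha> $ \<beta> / w $ \<beta>) + h w $ \<alpha>))"
      unfolding \<eta>_def residue_matrix_eq[OF s]
      by (rule lens_integral_cong[OF r(1)]) (simp only: component_torus[OF r])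
    then show ?thesis
      unfolding \<D>_def
      by (simp only: lens_integral_sq_decomposition[OF r h jacobian_at_0_eq[OF s]])
  qed
  then have "lens_inner r f f = (\<Sum>\<alpha>\<in>UNIV.
      (\<Sum>\<beta>\<in>UNIV. cnj (\<eta> $ \<alpha> $ \<beta>) * \<eta> $ \<alpha> $ \<beta>) / (of_real r)\<^sup>2 + cnj (h 0 $ \<alpha>) * h 0 $ \<alpha>
      + (of_real r)\<^sup>2 * (\<Sum>\<beta>\<in>UNIV. cnj (\<D> $ \<alpha> $ \<beta>) * \<D> $ \<alpha> $ \<beta>)
      + lens_integral r (\<lambda>w. cnj (?p \<alpha> w) * ?p \<alpha> w))"
    by (simp only: lens_inner_self_eq_sum[OF r(1) continuous_on_torus_component[OF r]])
  \<comment> \<open>Subtracting the squared norm of this mean removes exactly the summands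
    \<open>cnj (h 0 $ \<alpha>) * h 0 $ \<alpha>\<close>.\<close>
  moreover have "lens_integral r f = h 0"
    by (simp add: vec_eq_iff lens_integral_component[OF r(1) continuous_on_torus_component[OF r]]
        lens_integral_core[OF r])
  ultimately show ?thesis
    unfolding lens_variance_def matrix_trace_conj_transpose inner
    by (simp only: of_real_norm_square_vec sum.distrib sum_distrib_left sum_divide_distrib) simp
qed

lemma lens_inner_higher_order_bound:
  assumes s: "0 < s" "s < R"
  obtains K where "\<And>r. 0 < r \<Longrightarrow> r \<le> s \<Longrightarrow>
    norm (lens_inner r (higher_order s f) (higher_order s f)) \<le> K * r ^ 4"
proof -
  let ?D = "jacobian_at_0 s f"
  let ?p = "\<lambda>\<alpha> w. h w $ \<alpha> - h 0 $ \<alpha> - (\<Sum>\<beta>\<in>UNIV. ?D $ \<alpha> $ \<beta> * w $ \<beta>)"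
  have hol: "holomorphic_mv (?p \<alpha>) (polydisc R)" for \<alpha>
    by (intro holomorphic_mv_intros h)
  have dp: "deriv (\<lambda>z. ?p \<alpha> (axis \<beta> z)) 0 = 0" for \<alpha> \<beta>
    using s by (intro deriv_remainder_axis[OF h]) (auto simp: jacobian_at_0_eq[OF s])
  \<comment> \<open>The quantifier order matters: C may depend on the component \<alpha> but must be
    uniform in r and w.\<close>
  have "\<exists>C\<ge>0. \<forall>r w. 0 < r \<longrightarrow> r \<le> s \<longrightarrow> w \<in> torus r \<longrightarrow> norm (?p \<alpha> w) \<le> C * r\<^sup>2" for \<alpha>
  proof -
    have "?p \<alpha> 0 = 0" by simp
    then obtain C where "0 \<le> C" "\<And>r w. 0 < r \<Longrightarrow> r \<le> s \<Longrightarrow> w \<in> torus r \<Longrightarrow> norm (?p \<alpha> w) \<le> C * r\<^sup>2"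
      using holomorphic_mv_second_order[OF hol s _ dp] by blast
    then show ?thesis by blast
  qed
  then obtain C where C: "\<And>\<alpha>. 0 \<le> C \<alpha>"
      "\<And>\<alpha> r w. 0 < r \<Longrightarrow> r \<le> s \<Longrightarrow> w \<in> torus r \<Longrightarrow> norm (?p \<alpha> w) \<le> C \<alpha> * r\<^sup>2"
    by metis
  show ?thesis
  \<comment> \<open>A mean is at most the supremum over the torus, so component \<alpha> contributes
    at most the square of \<open>C \<alpha> * r\<^sup>2\<close>.\<close>
  proof (rule that[of "\<Sum>\<alpha>\<in>UNIV. (C \<alpha>)\<^sup>2"])
    fix r assume rs: "0 < r" "r \<le> s"
    then have r: "0 < r" "r < R" using s by auto
    have ho: "higher_order s f w $ \<alpha> = ?p \<alpha> w" if "w \<in> torus r" for w \<alpha>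
      using that torus_subset_polydisc[OF r(2)] by (intro higher_order_eq[OF s]) auto
    have cont: "continuous_on (torus r) (\<lambda>w. higher_order s f w $ \<alpha>)" for \<alpha>
      using holomorphic_mv_continuous_on_torus[OF r hol] by (simp add: ho cong: continuous_on_cong)
    have "norm (lens_integral r (\<lambda>w. cnj (higher_order s f w $ \<alpha>) * higher_order s f w $ \<alpha>))
        \<le> (C \<alpha>)\<^sup>2 * r ^ 4" for \<alpha>
    proof (rule norm_lens_integral_le[OF r(1)])
      show "continuous_on (torus r) (\<lambda>w. cnj (higher_order s f w $ \<alpha>) * higher_order s f w $ \<alpha>)"
        by (intro continuous_intros cont)
      fix w :: "(complex, 'n) vec" assume w: "w \<in> torus r"
      have "norm (cnj (higher_order s f w $ \<alpha>) * higher_order s f w $ \<alpha>) = (norm (?p \<alpha> w))\<^sup>2"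
        by (simp only: ho[OF w] norm_mult complex_mod_cnj power2_eq_square)
      also have "\<dots> \<le> (C \<alpha> * r\<^sup>2)\<^sup>2"
        by (intro power_mono C(2) rs w norm_ge_zero)
      finally show "norm (cnj (higher_order s f w $ \<alpha>) * higher_order s f w $ \<alpha>) \<le> (C \<alpha>)\<^sup>2 * r ^ 4"
        by (simp add: power_mult_distrib flip: power_mult)
    qed
    then show "norm (lens_inner r (higher_order s f) (higher_order s f)) \<le> (\<Sum>\<alpha>\<in>UNIV. (C \<alpha>)\<^sup>2) * r ^ 4"
      unfolding lens_inner_self_eq_sum[OF r(1) cont] sum_distrib_right by (rule sum_norm_le)
  qed
qed

end

text \<open>The two-term formula is the limiting form for small radius. For n = k = 1 and f w = w^2
  both matrices vanish while the variance is r^4, so the remainder term is genuine and the order 4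
  cannot be improved in general.\<close>

theorem theorem3p3:
  fixes f :: "complex ^ ('n :: {finite, linorder}) \<Rightarrow> complex ^ 'k"
    and \<eta> \<D> :: "complex ^ ('n :: {finite, linorder}) ^ 'k" and R s :: real
  assumes "f \<in> lens_functions"
    and "single_pole_at_0 R f"
    and "0 < s" and "s < R"
    and "\<eta> = residue_matrix s f"
    and "\<D> = jacobian_at_0 s f"
  shows "(\<forall>r\<in>{0<..<R}. lens_variance r f =
            trace (conj_transpose \<eta> ** \<eta>) / (complex_of_real r)\<^sup>2
            + (complex_of_real r)\<^sup>2 * trace (conj_transpose \<D> ** \<D>)
            + lens_inner r (higher_order s f) (higher_order s f))
       \<and> (\<lambda>r. lens_variance r f -
            (trace (conj_transpose \<eta> ** \<eta>) / (complex_of_real r)\<^sup>2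
             + (complex_of_real r)\<^sup>2 * trace (conj_transpose \<D> ** \<D>)))
           \<in> O[at_right 0](\<lambda>r. (complex_of_real r) ^ 4)"
proof -
  obtain c :: "'n \<Rightarrow> complex ^ 'k" and h where h: "\<And>\<alpha>. holomorphic_mv (\<lambda>w. h w $ \<alpha>) (polydisc R)"
      and f: "\<And>w. w \<in> polydisc R \<inter> off_axes \<Longrightarrow> f w = (\<Sum>\<beta>\<in>UNIV. (1 / w $ \<beta>) *s c \<beta>) + h w"
    using assms(2) unfolding single_pole_at_0_def by blast
  note s = assms(3,4)
  have eq: "lens_variance r f =
      trace (conj_transpose \<eta> ** \<eta>) / (complex_of_real r)\<^sup>2
      + (complex_of_real r)\<^sup>2 * trace (conj_transpose \<D> ** \<D>)
      + lens_inner r (higher_order s f) (higher_order s f)" if "0 < r" "r < R" for r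
    unfolding assms(5,6) by (rule lens_variance_eq[OF h f s that])
  obtain K where K: "\<And>r. 0 < r \<Longrightarrow> r \<le> s \<Longrightarrow>
      norm (lens_inner r (higher_order s f) (higher_order s f)) \<le> K * r ^ 4"
    using lens_inner_higher_order_bound[OF h f s] by blast
  have "(\<lambda>r. lens_variance r f -
        (trace (conj_transpose \<eta> ** \<eta>) / (complex_of_real r)\<^sup>2
         + (complex_of_real r)\<^sup>2 * trace (conj_transpose \<D> ** \<D>)))
      \<in> O[at_right 0](\<lambda>r. (complex_of_real r) ^ 4)"
  \<comment> \<open>The interval ends at s because the constant K is uniform only for radii up to
    s.\<close>
  proof (rule bigoI[of _ K], rule eventually_at_rightI[of 0 s])
    fix r assume "r \<in> {0<..<s}"
    then show "norm (lens_variance r f -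
        (trace (conj_transpose \<eta> ** \<eta>) / (complex_of_real r)\<^sup>2
         + (complex_of_real r)\<^sup>2 * trace (conj_transpose \<D> ** \<D>)))
      \<le> K * norm ((complex_of_real r) ^ 4)"
      using K[of r] eq[of r] s by (simp add: norm_power)
  qed (rule s(1))
  then show ?thesis using eq by auto
qed

end
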